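(* Let $q$ be a prime power and $r>h\ge 1$ integers, and put $k=r/h$. Each $[n,r/h,d]_q^h$ code satisfies $$n\ge \left\lceil \frac{g_q\!\left(r,d\cdot q^{h-1}\right)}{[h]_q}\right\rceil = \left\lceil\frac{\sum_{i=0}^{r-1}\left\lceil d\cdot q^{h-1-i}\right\rceil}{[h]_q}\right\rceil =d+ \left\lceil \frac{g_q(r-h+1,d)-d}{[h]_q}\right\rceil .$$ If $d$ is sufficiently large, given $r$, $h$, and $q$, then this inequality can always be attained with equality. For increasing minimum distance $d$ the relative distance $\delta=\frac{d}{n}$ (of the codes attaining equality) tends to $\frac{q^{k-1}}{[k]_q}=1-\frac{1}{q}+O\!\left(q^{-2}\right)$ and the rate $R=\frac{k}{n}$ tends to zero.
   Context: Notation: $[i]_q=\frac{q^i-1}{q-1}$ and $g_q(m,d)=\sum_{i=0}^{m-1}\left\lceil d/q^i\right\rceil$ for positive integers $m,d$. An $[n,r/h,d]_q^h$ code is an $\mathbb{F}_q$-linear subspace $C$ of $\mathbb{F}_{q^h}^n$ (an additive code over the alphabet $\mathbb{F}_{q^h}$) with $\#C=q^r$ and minimum Hamming distance $d$, where the Hamming distance counts differing coordinates over the alphabet $\mathbb{F}_{q^h}$. The number $k=r/h$, which may be fractional, is called the dimension of $C$, so that $\#C=(q^h)^k$.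
   Formalization: The limit of d/n is stated as Q^{k-1}/[k]_Q with Q=q^h, since base q is wrong for h>1 (q=h=2, r=4 gives 4/5, not 2/3); the error term, for fixed k and base tending to infinity, is O(base^{-2}) only for k≥2 and O(base^{-k}) for k<2, where the printed order fails. *)

theory Defs
  imports
    "HOL-Library.Cardinality"
    "HOL-Library.Landau_Symbols"
    "HOL-Number_Theory.Prime_Powers"
    "HOL-Algebra.Subrings"
    "Jordan_Normal_Form.VS_Connect"
begin

text \<open>The number \<open>[x]\<^sub>q\<close>; the index \<open>x\<close> is real because the dimension of an additive code may
  be fractional.\<close>

definition q_number :: "real \<Rightarrow> real \<Rightarrow> real" where
  "q_number q x = (q powr x - 1) / (q - 1)"

definition griesmer_sum :: "nat \<Rightarrow> nat \<Rightarrow> nat \<Rightarrow> int" where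
  "griesmer_sum q m d = (\<Sum>i<m. \<lceil>real d / real q ^ i\<rceil>)"

definition hamming_dist :: "'a vec \<Rightarrow> 'a vec \<Rightarrow> nat" where
  "hamming_dist u v = card {i. i < dim_vec u \<and> u $ i \<noteq> v $ i}"

definition min_hamming_dist :: "'a vec set \<Rightarrow> nat" where
  "min_hamming_dist C = Min {hamming_dist u v | u v. u \<in> C \<and> v \<in> C \<and> u \<noteq> v}"

text \<open>The type \<open>'a\<close> is the alphabet of order \<open>q\<^sup>h\<close> and \<open>K\<close> is its subfield of order \<open>q\<close>.
  Vectors of length \<open>n\<close> over the alphabet are regarded as a vector space over \<open>K\<close> only, so a code
  need not be closed under scaling by elements outside \<open>K\<close>; distances still count coordinates over
  the whole alphabet. Membership in \<open>carrier_vec n\<close> is part of being a subspace. The parameter \<open>r\<close>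
  is the \<open>K\<close>-dimension, and \<open>d\<close> is the exact minimum distance.\<close>

definition additive_code ::
  "'a::{field,finite} set \<Rightarrow> nat \<Rightarrow> nat \<Rightarrow> nat \<Rightarrow> 'a vec set \<Rightarrow> bool" where
  "additive_code K n r d C \<longleftrightarrow>
     VectorSpace.subspace (class_ring\<lparr>carrier := K\<rparr>) C (module_vec TYPE('a) n) \<and>
     card C = card K ^ r \<and>
     min_hamming_dist C = d"

definition additive_griesmer_bound :: "nat \<Rightarrow> nat \<Rightarrow> nat \<Rightarrow> nat \<Rightarrow> int" where
  "additive_griesmer_bound q h r d =
     \<lceil>of_int (griesmer_sum q r (d * q ^ (h - 1))) / q_number (real q) (real h)\<rceil>"

end

theory Submission
  imports Defs "HOL-Library.Function_Algebras"
begin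

text \<open>Write \<open>[i]\<close> for \<open>gnum q i\<close> and put \<open>t = r - h\<close>. The lower bound is the Griesmer bound for the
  linear code obtained by replacing each coordinate of the alphabet by the hyperplanes of the
  alphabet over \<open>K\<close>.

  For the converse, a code word is the sequence of values of \<open>n\<close> surjective \<open>K\<close>-linear maps from an
  \<open>r\<close>-dimensional space \<open>V\<close> to the alphabet. So one needs \<open>n = d + e\<close> subspaces of dimension \<open>t\<close>, the
  kernels, such that no nonzero vector lies in more than \<open>e\<close> of them. Adding all \<open>t\<close>-subspaces equally
  often changes \<open>d\<close> and the bound compatibly, so that for large \<open>d\<close> it is enough to find integer
  multiplicities, possibly negative. Hence one computes modulo the lattice spanned by the indicator
  functions of the \<open>t\<close>-subspaces. Modulo it, \<open>q ^ l \<cdot> 1\<^sub>S + [l] \<cdot> 1\<^sub>W\<close> vanishes if \<open>S \<subseteq> W\<close> have dimensions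
  \<open>t - l\<close> and \<open>t + 1\<close>, and \<open>1\<^sub>V\<close> is congruent to \<open>[h] \<cdot> 1\<^sub>W\<close>. With \<open>d = s q ^ t - (\<Sum>l<t. \<epsilon>\<^sub>l q ^ l)\<close>, as in the
  Solomon--Stiffler construction, the function
  \<open>e - (\<Sum>l<t. \<epsilon>\<^sub>l q ^ l \<cdot> 1\<^bsub>S(t-l)\<^esub>) - a q ^ t \<cdot> 1\<^bsub>S(1)\<^esub> + (s + a) q ^ t \<cdot> 1\<^bsub>{0}\<^esub>\<close> lies in the lattice
  when \<open>e [h] = a + s [t] - (\<Sum>l<t. \<epsilon>\<^sub>l [l])\<close>, and its value \<open>d + e\<close> at \<open>0\<close> counts the subspaces.\<close>

section \<open>Griesmer sums\<close>

definition gnum :: "nat \<Rightarrow> nat \<Rightarrow> nat" where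
  "gnum q n = (\<Sum>i<n. q ^ i)"

lemma gnum_0 [simp]: "gnum q 0 = 0" and gnum_Suc: "gnum q (Suc n) = gnum q n + q ^ n"
  by (simp_all add: gnum_def)

lemma gnum_Suc': "gnum q (Suc n) = Suc (q * gnum q n)"
  unfolding gnum_def by (subst sum.lessThan_Suc_shift) (simp add: sum_distrib_left)

lemma gnum_mult:
  assumes "0 < q"
  shows "gnum q n * (q - 1) + 1 = q ^ n"
proof (induction n)
  case (Suc n)
  have "gnum q (Suc n) * (q - 1) + 1 = (gnum q n * (q - 1) + 1) + q ^ n * (q - 1)"
    by (simp add: gnum_Suc algebra_simps)
  also have "\<dots> = q ^ n + q ^ n * (q - 1)" using Suc by simp
  also have "\<dots> = q ^ Suc n" using assms by (cases q) auto
  finally show ?case .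
qed simp

lemma gnum_mult': "0 < q \<Longrightarrow> gnum q n * (q - 1) = q ^ n - 1"
  using gnum_mult[of q n] by simp

lemma gnum_pos: "0 < n \<Longrightarrow> 0 < gnum q n"
  by (cases n) (simp_all add: gnum_Suc')

lemma gnum_add: "gnum q (m + n) = gnum q m + q ^ m * gnum q n"
  by (induction n) (simp_all add: gnum_Suc power_add algebra_simps)

section \<open>Ceiling sums, their digits and their behaviour under shifts\<close>

text \<open>In integer arithmetic \<open>- (- a div b)\<close> is the ceiling of
  \<open>a / b\<close>. The divisors start at \<open>q\<close>, so this is the Griesmer sum of
  length \<open>t + 1\<close> without its leading term \<open>d\<close>.\<close>

definition ceil_sum :: "nat \<Rightarrow> nat \<Rightarrow> int \<Rightarrow> int" where
  "ceil_sum q t d = (\<Sum>i<t. - (- d div int q ^ Suc i))"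

text \<open>The number \<open>e\<close> of the overview: what the bound adds to \<open>d\<close>,
  hence how many kernels may share a nonzero vector.\<close>

definition excess :: "nat \<Rightarrow> nat \<Rightarrow> nat \<Rightarrow> int \<Rightarrow> int" where
  "excess q h t d = - (- ceil_sum q t d div int (gnum q h))"

lemma ceil_sum_Suc:
  "ceil_sum q (Suc t) d = - (- d div int q) + ceil_sum q t (- (- d div int q))"
  unfolding ceil_sum_def
  by (subst sum.lessThan_Suc_shift) (simp add: zdiv_zmult2_eq)

text \<open>Rounding \<open>d\<close> up to a multiple of \<open>q\<close> splits off the digit
  \<open>- d mod q\<close> and leaves the ceiling of \<open>d / q\<close>, to which the same
  applies. As ceilings iterate, the ceiling sum is linear in the digits, with \<open>[l]\<close> in
  place of \<open>q ^ l\<close>.\<close>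

lemma ceil_sum_digits:
  assumes "0 < q"
  shows "\<exists>s \<epsilon>. (\<forall>l. 0 \<le> \<epsilon> l) \<and> d = s * int q ^ t - (\<Sum>l<t. \<epsilon> l * int q ^ l) \<and>
           ceil_sum q t d = s * int (gnum q t) - (\<Sum>l<t. \<epsilon> l * int (gnum q l))"
proof (induction t arbitrary: d)
  case 0
  show ?case by (auto simp: ceil_sum_def intro: exI[of _ "\<lambda>_. 0"])
next
  case (Suc t)
  define d' where "d' = - (- d div int q)"
  obtain s \<epsilon> where IH: "\<And>l. 0 \<le> \<epsilon> l" "d' = s * int q ^ t - (\<Sum>l<t. \<epsilon> l * int q ^ l)"
      "ceil_sum q t d' = s * int (gnum q t) - (\<Sum>l<t. \<epsilon> l * int (gnum q l))"
    using Suc.IH[of d'] by blast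
  define \<delta> where "\<delta> = case_nat (- d mod int q) \<epsilon>"
  have d: "d = int q * d' - \<delta> 0"
    unfolding d'_def \<delta>_def using minus_mult_div_eq_mod[of "- d" "int q"] by simp
  show ?case
  proof (intro exI[of _ s] exI[of _ \<delta>] conjI)
    show "\<forall>l. 0 \<le> \<delta> l"
      using IH(1) assms by (auto simp: \<delta>_def split: nat.splits)
    have "int q * d' = s * int q ^ Suc t - (\<Sum>l<t. \<epsilon> l * int q ^ Suc l)"
      unfolding IH(2) by (simp add: algebra_simps sum_distrib_left)
    thus "d = s * int q ^ Suc t - (\<Sum>l<Suc t. \<delta> l * int q ^ l)"
      by (subst d, subst sum.lessThan_Suc_shift) (simp add: \<delta>_def)
    have "ceil_sum q (Suc t) d = d' + ceil_sum q t d'"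
      by (simp add: ceil_sum_Suc d'_def)
    \<comment> \<open>Adding \<open>d'\<close> to its own ceiling sum merges each
      \<open>q ^ l\<close> with \<open>[l]\<close> into \<open>[l + 1]\<close>.\<close>
    also have "\<dots> = s * int (gnum q (Suc t)) - (\<Sum>l<t. \<epsilon> l * int (gnum q (Suc l)))"
      unfolding IH(3) by (subst IH(2)) (simp add: gnum_Suc algebra_simps sum.distrib)
    also have "\<dots> = s * int (gnum q (Suc t)) - (\<Sum>l<Suc t. \<delta> l * int (gnum q l))"
      by (subst sum.lessThan_Suc_shift) (simp add: \<delta>_def)
    finally show "ceil_sum q (Suc t) d = s * int (gnum q (Suc t)) - (\<Sum>l<Suc t. \<delta> l * int (gnum q l))" .
  qed
qed

text \<open>Each divisor \<open>q ^ (i + 1)\<close> with \<open>i < t\<close> divides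
  \<open>q ^ t\<close>, so the added term leaves every ceiling exactly; the quotients add up to
  \<open>y * [t]\<close>.\<close>

lemma ceil_sum_shift:
  assumes "0 < q"
  shows "ceil_sum q t (d + int q ^ t * y) = ceil_sum q t d + y * int (gnum q t)"
proof -
  have "- (d + int q ^ t * y) div int q ^ Suc i = - d div int q ^ Suc i - int q ^ (t - Suc i) * y"
    if "i < t" for i
  proof -
    have *: "int q ^ t = int q ^ Suc i * int q ^ (t - Suc i)"
      using that by (simp only: power_add[symmetric]) simp
    have shift: "- (d + int q ^ t * y) = - d + int q ^ Suc i * (- (int q ^ (t - Suc i) * y))"
      by (subst *) (simp add: algebra_simps)
    have "int q ^ Suc i \<noteq> 0" using assms by simp
    thus ?thesis
      unfolding shift by (subst div_mult_self2) simp_all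
  qed
  hence "ceil_sum q t (d + int q ^ t * y) = (\<Sum>i<t. - (- d div int q ^ Suc i) + int q ^ (t - Suc i) * y)"
    unfolding ceil_sum_def by (intro sum.cong) auto
  also have "\<dots> = ceil_sum q t d + (\<Sum>i<t. int q ^ (t - Suc i)) * y"
    by (simp only: sum.distrib ceil_sum_def sum_distrib_right)
  also have "(\<Sum>i<t. int q ^ (t - Suc i)) = int (gnum q t)"
    by (simp add: gnum_def sum.nat_diff_reindex)
  finally show ?thesis by (simp add: mult.commute)
qed

text \<open>The hypothesis makes the change of the ceiling sum a multiple of \<open>[h]\<close>, so
  it passes through the outer ceiling too. Suitable \<open>y\<close> and \<open>z\<close> will come
  from adding all \<open>t\<close>-subspaces equally.\<close>

lemma excess_shift:
  assumes "0 < q" "0 < h" "y * gnum q t = z * gnum q h"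
  shows "excess q h t (d + int q ^ t * (int c * int y)) = excess q h t d + int c * int z"
proof -
  have "ceil_sum q t (d + int q ^ t * (int c * int y)) = ceil_sum q t d + int c * int (y * gnum q t)"
    by (simp add: ceil_sum_shift[OF assms(1)] mult.assoc)
  also have "\<dots> = ceil_sum q t d + int (gnum q h) * (int c * int z)"
    by (subst assms(3)) (simp add: mult_ac)
  finally have "- ceil_sum q t (d + int q ^ t * (int c * int y)) =
      - ceil_sum q t d + int (gnum q h) * (- (int c * int z))"
    by simp
  moreover have "int (gnum q h) \<noteq> 0"
    using gnum_pos[OF \<open>0 < h\<close>, of q] by simp
  ultimately show ?thesis
    unfolding excess_def by (simp only: div_mult_self2 simp_thms)
qed

lemma excess_ge:
  assumes "0 < h"
  shows "ceil_sum q t d \<le> excess q h t d * int (gnum q h)"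
proof -
  have "0 \<le> - ceil_sum q t d mod int (gnum q h)"
    using gnum_pos[OF assms, of q] by simp
  thus ?thesis
    unfolding excess_def by (simp add: minus_div_mult_eq_mod [symmetric])
qed

section \<open>The bound as \<open>d\<close> plus the excess\<close>

lemma griesmer_sum_conv:
  "griesmer_sum q m d = (\<Sum>i<m. - (- int d div int q ^ i))"
  unfolding griesmer_sum_def
  by (intro sum.cong refl) (metis ceiling_divide_eq_div of_int_of_nat_eq of_nat_power)

lemma griesmer_sum_Suc:
  "griesmer_sum q (Suc m) d = int d + griesmer_sum q m (nat (- (- int d div int q)))"
proof -
  have "- int d div int q \<le> 0"
    using zdiv_mono1[of "- int d" 0 "int q"] by (cases "q = 0") auto
  hence "int (nat (- (- int d div int q))) = - (- int d div int q)" by simp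
  thus ?thesis
    unfolding griesmer_sum_conv
    by (subst sum.lessThan_Suc_shift) (simp add: zdiv_zmult2_eq)
qed

lemma q_number_gnum:
  assumes "2 \<le> q"
  shows "q_number (real q) (real n) = real (gnum q n)"
proof -
  have "real (gnum q n * (q - 1) + 1) = real (q ^ n)"
    using assms by (subst gnum_mult) auto
  hence "real (gnum q n) * (real q - 1) = real q ^ n - 1"
    using assms by (simp add: of_nat_diff)
  thus ?thesis
    using assms by (simp add: q_number_def powr_realpow field_simps)
qed

lemma griesmer_sum_residual: "griesmer_sum q (Suc t) d = int d + ceil_sum q t (int d)"
  unfolding griesmer_sum_conv ceil_sum_def by (subst sum.lessThan_Suc_shift) simp

lemma sum_lessThan_add: "(\<Sum>i<m + (n::nat). f i) = (\<Sum>i<m. f i) + (\<Sum>i<n. f (m + i) :: 'z::comm_monoid_add)"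
  by (induction n) (simp_all add: add.assoc)

text \<open>The first \<open>h\<close> quotients are integers and add up to \<open>d * [h]\<close>;
  in the others \<open>q ^ (h - 1)\<close> cancels and leaves the ceilings of
  \<open>d / q ^ (i + 1)\<close>.\<close>

lemma griesmer_sum_concatenated:
  assumes "2 \<le> q" "1 \<le> h"
  shows "griesmer_sum q (h + t) (d * q ^ (h - 1)) = int d * int (gnum q h) + ceil_sum q t (int d)"
proof -
  have 1: "- (- int (d * q ^ (h - 1)) div int q ^ i) = int d * int q ^ (h - Suc i)" if "i < h" for i
  proof -
    have "int q ^ (h - 1) = int q ^ (h - Suc i) * int q ^ i"
      using that by (simp flip: power_add)
    hence "- int (d * q ^ (h - 1)) = - (int d * int q ^ (h - Suc i)) * int q ^ i"
      by simp
    thus ?thesis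
      using assms(1) by (subst \<open>- int (d * q ^ (h - 1)) = _\<close>, subst nonzero_mult_div_cancel_right) auto
  qed
  have 2: "- (- int (d * q ^ (h - 1)) div int q ^ (h + i)) = - (- int d div int q ^ Suc i)" for i
  proof -
    have eq: "int q ^ (h + i) = int q ^ Suc i * int q ^ (h - 1)"
      "- int (d * q ^ (h - 1)) = - int d * int q ^ (h - 1)"
      using assms(2) by (simp_all only: power_add[symmetric]) (simp_all add: add.commute)
    show ?thesis
      unfolding eq using assms(1) by (subst div_mult_mult2) simp_all
  qed
  have "griesmer_sum q (h + t) (d * q ^ (h - 1)) =
      (\<Sum>i<h. int d * int q ^ (h - Suc i)) + (\<Sum>i<t. - (- int d div int q ^ Suc i))"
    unfolding griesmer_sum_conv sum_lessThan_add using 1 2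
    by (intro arg_cong2[of _ _ _ _ "(+)"] sum.cong) auto
  also have "(\<Sum>i<h. int d * int q ^ (h - Suc i)) = int d * int (gnum q h)"
    by (simp add: gnum_def sum.nat_diff_reindex flip: sum_distrib_left)
  finally show ?thesis unfolding ceil_sum_def .
qed

text \<open>The summand \<open>d * [h]\<close> leaves the outer ceiling as \<open>d\<close>.\<close>

lemma additive_griesmer_bound_eq:
  assumes "2 \<le> q" "1 \<le> h"
  shows "additive_griesmer_bound q h (h + t) d = int d + excess q h t (int d)"
proof -
  have "gnum q h \<noteq> 0" using gnum_pos[of h q] assms by simp
  have "additive_griesmer_bound q h (h + t) d =
      - (- (int d * int (gnum q h) + ceil_sum q t (int d)) div int (gnum q h))"
    unfolding additive_griesmer_bound_def q_number_gnum[OF assms(1)] griesmer_sum_concatenated[OF assms]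
    by (subst ceiling_divide_eq_div[symmetric]) simp
  also have "- (int d * int (gnum q h) + ceil_sum q t (int d)) =
      - ceil_sum q t (int d) + int (gnum q h) * (- int d)"
    by simp
  finally show ?thesis
    using \<open>gnum q h \<noteq> 0\<close> unfolding excess_def by (subst (asm) div_mult_self2) simp_all
qed

section \<open>Subspaces over a subfield\<close>

text \<open>\<open>K\<close> is a set because the subfield has no type of its own. There are two
  instances, the alphabet acting on itself and words over the alphabet; subspaces are meant over
  \<open>K\<close>.\<close>

locale subfield_space = vector_space scale
  for scale :: "'a::field \<Rightarrow> 'b::ab_group_add \<Rightarrow> 'b" (infixr \<open>*s\<close> 75) +
  fixes K :: "'a set" and q :: nat
  assumes zero_K: "0 \<in> K" and one_K: "1 \<in> K"
    and add_K: "x \<in> K \<Longrightarrow> y \<in> K \<Longrightarrow> x + y \<in> K"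
    and uminus_K: "x \<in> K \<Longrightarrow> - x \<in> K"
    and mult_K: "x \<in> K \<Longrightarrow> y \<in> K \<Longrightarrow> x * y \<in> K"
    and inverse_K: "x \<in> K \<Longrightarrow> inverse x \<in> K"
    and finite_K: "finite K" and card_K: "card K = q"
begin

lemma q_ge_2: "2 \<le> q"
proof -
  have "card {0::'a, 1} \<le> card K"
    by (rule card_mono) (use finite_K zero_K one_K in auto)
  thus ?thesis by (simp add: card_K)
qed

lemma q_pos: "0 < q"
  using q_ge_2 by simp

lemma diff_K: "x \<in> K \<Longrightarrow> y \<in> K \<Longrightarrow> x - y \<in> K"
  using add_K[of x "- y"] uminus_K by simp

definition sub :: "'b set \<Rightarrow> bool" where
  "sub S \<longleftrightarrow> 0 \<in> S \<and> (\<forall>x\<in>S. \<forall>y\<in>S. x + y \<in> S) \<and> (\<forall>c\<in>K. \<forall>x\<in>S. c *s x \<in> S)"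

lemma sub_zero: "sub S \<Longrightarrow> 0 \<in> S"
  and sub_add: "sub S \<Longrightarrow> x \<in> S \<Longrightarrow> y \<in> S \<Longrightarrow> x + y \<in> S"
  and sub_scale: "sub S \<Longrightarrow> c \<in> K \<Longrightarrow> x \<in> S \<Longrightarrow> c *s x \<in> S"
  by (auto simp: sub_def)

lemma sub_uminus: "sub S \<Longrightarrow> x \<in> S \<Longrightarrow> - x \<in> S"
  using sub_scale[of S "- 1" x] uminus_K one_K by simp

lemma sub_diff: "sub S \<Longrightarrow> x \<in> S \<Longrightarrow> y \<in> S \<Longrightarrow> x - y \<in> S"
  using sub_add[of S x "- y"] sub_uminus by simp

lemma sub_scaleD: "sub S \<Longrightarrow> c \<in> K \<Longrightarrow> c \<noteq> 0 \<Longrightarrow> c *s x \<in> S \<Longrightarrow> x \<in> S"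
  using sub_scale[of S "inverse c" "c *s x"] inverse_K by simp

lemma sub_singleton_zero: "sub {0}"
  by (auto simp: sub_def)

text \<open>For a subspace \<open>S\<close>, the span of \<open>S\<close> and
  \<open>v\<close>.\<close>

definition adj :: "'b set \<Rightarrow> 'b \<Rightarrow> 'b set" where
  "adj S v = (\<lambda>(s, c). s + c *s v) ` (S \<times> K)"

lemma adjI: "s \<in> S \<Longrightarrow> c \<in> K \<Longrightarrow> s + c *s v \<in> adj S v"
  by (auto simp: adj_def)

lemma subset_adj: "S \<subseteq> adj S v"
  using adjI[of _ S 0 v] zero_K by auto

lemma mem_adj: "sub S \<Longrightarrow> v \<in> adj S v"
  using adjI[of 0 S 1 v] one_K by (simp add: sub_zero)

lemma sub_adj:
  assumes "sub S" shows "sub (adj S v)"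
  unfolding sub_def
proof (intro conjI ballI)
  show "0 \<in> adj S v"
    using subset_adj sub_zero[OF assms] by auto
next
  fix x y assume "x \<in> adj S v" "y \<in> adj S v"
  then obtain s c s' c' where 1: "s \<in> S" "c \<in> K" "s' \<in> S" "c' \<in> K"
      "x = s + c *s v" "y = s' + c' *s v"
    by (auto simp: adj_def)
  have "x + y = (s + s') + (c + c') *s v"
    using 1 by (simp add: scale_left_distrib add_ac)
  thus "x + y \<in> adj S v"
    using adjI[of "s + s'" S "c + c'" v] 1(1-4) assms by (simp add: sub_add add_K)
next
  fix a x assume "a \<in> K" "x \<in> adj S v"
  then obtain s c where 1: "s \<in> S" "c \<in> K" "x = s + c *s v"
    by (auto simp: adj_def)
  have "a *s x = a *s s + (a * c) *s v"
    using 1 by (simp add: scale_right_distrib)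
  thus "a *s x \<in> adj S v"
    using adjI[of "a *s s" S "a * c" v] 1 \<open>a \<in> K\<close> assms by (simp add: sub_scale mult_K)
qed

lemma adj_subset: "sub T \<Longrightarrow> S \<subseteq> T \<Longrightarrow> v \<in> T \<Longrightarrow> adj S v \<subseteq> T"
  by (auto simp: adj_def intro!: sub_add sub_scale)

lemma finite_adj: "finite S \<Longrightarrow> finite (adj S v)"
  by (simp add: adj_def finite_K)

lemma card_adj:
  assumes "sub S" "v \<notin> S"
  shows "card (adj S v) = q * card S"
proof -
  have "inj_on (\<lambda>(s, c). s + c *s v) (S \<times> K)"
  proof (rule inj_onI, clarsimp)
    fix s c s' c' assume 1: "s \<in> S" "c \<in> K" "s' \<in> S" "c' \<in> K" "s + c *s v = s' + c' *s v"
    hence "(c - c') *s v = s' - s"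
      by (simp add: scale_left_diff_distrib algebra_simps)
    hence "(c - c') *s v \<in> S"
      using 1 assms by (simp add: sub_diff)
    hence "c = c'"
      using sub_scaleD[OF \<open>sub S\<close>, of "c - c'" v] diff_K 1 assms by auto
    thus "s = s' \<and> c = c'"
      using 1 by simp
  qed
  hence "card (adj S v) = card (S \<times> K)"
    unfolding adj_def by (rule card_image)
  thus ?thesis
    by (simp add: card_cartesian_product card_K)
qed

lemma exists_sub_between:
  assumes "sub S" "sub W" "finite W" "S \<subseteq> W" "card S = q ^ i" "card W = q ^ k" "i \<le> j" "j \<le> k"
  shows "\<exists>T. sub T \<and> S \<subseteq> T \<and> T \<subseteq> W \<and> card T = q ^ j"
  using assms(7,8)
proof (induction j rule: dec_induct)
  case base
  thus ?case using assms by blast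
next
  case (step j)
  then obtain T where T: "sub T" "S \<subseteq> T" "T \<subseteq> W" "card T = q ^ j" by auto
  have "card T < card W"
    using T step assms q_ge_2 by simp
  then obtain v where v: "v \<in> W" "v \<notin> T"
    using T by (metis less_irrefl subset_antisym subsetI)
  show ?case
    using T v assms subset_adj[of T v] adj_subset[of W T v] card_adj[of T v] sub_adj[of T v]
    by (intro exI[of _ "adj T v"]) auto
qed

section \<open>Counting the subspaces between two given ones\<close>

text \<open>Dimension \<open>t\<close> is expressed as cardinality \<open>q ^ t\<close>, which avoids bases altogether.\<close>

definition intermediate :: "'b set \<Rightarrow> nat \<Rightarrow> 'b set \<Rightarrow> 'b set set" where
  "intermediate S t W = {T. sub T \<and> S \<subseteq> T \<and> T \<subseteq> W \<and> card T = q ^ t}"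

lemma finite_intermediate: "finite W \<Longrightarrow> finite (intermediate S t W)"
  by (rule finite_subset[of _ "Pow W"]) (auto simp: intermediate_def)

text \<open>Turns the incidence \<open>v \<in> T\<close> into containment of a larger subspace, so
  that the counts below can induct downwards on the dimension of \<open>S\<close>.\<close>

lemma intermediate_adj:
  "sub S \<Longrightarrow> intermediate (adj S v) t W = {T \<in> intermediate S t W. v \<in> T}"
  using subset_adj[of S v] mem_adj[of S v] adj_subset
  by (fastforce simp: intermediate_def)

lemma intermediate_self:
  assumes "sub S" "S \<subseteq> W" "finite W" "card S = q ^ t"
  shows "intermediate S t W = {S}"
proof -
  have "T = S" if "T \<in> intermediate S t W" for T
    using that assms card_subset_eq[of T S] finite_subset[of T W]
    by (auto simp: intermediate_def)
  thus ?thesis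
    using assms by (auto simp: intermediate_def)
qed

text \<open>Both sides count the pairs of an intermediate \<open>T\<close> and a vector of
  \<open>T - S\<close>.\<close>

lemma double_count_intermediate:
  assumes "sub S" "S \<subseteq> W" "finite W" "card S = q ^ j"
  shows "card (intermediate S t W) * (q ^ t - q ^ j) =
         (\<Sum>v\<in>W - S. card (intermediate (adj S v) t W))"
proof -
  have fin: "finite (intermediate S t W)" "finite S"
    using assms finite_intermediate finite_subset by auto
  have "(\<Sum>v\<in>W - S. card (intermediate (adj S v) t W)) =
        (\<Sum>v\<in>W - S. card {T \<in> intermediate S t W. v \<in> T})"
    using assms by (simp add: intermediate_adj)
  also have "\<dots> = (\<Sum>T\<in>intermediate S t W. q ^ t - q ^ j)"
  proof (rule sum_multicount_gen)
    show "\<forall>T\<in>intermediate S t W. card {v \<in> W - S. v \<in> T} = q ^ t - q ^ j"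
    proof
      fix T assume T: "T \<in> intermediate S t W"
      hence "{v \<in> W - S. v \<in> T} = T - S"
        by (auto simp: intermediate_def)
      thus "card {v \<in> W - S. v \<in> T} = q ^ t - q ^ j"
        using T fin assms by (simp add: card_Diff_subset intermediate_def)
    qed
  qed (use fin assms in auto)
  finally show ?thesis by simp
qed

text \<open>Downward induction on \<open>j\<close>: by hypothesis for \<open>j + 1\<close>, all
  terms on the right of the double count are \<open>[t - j]\<close>, and the equation is solved for
  the number sought.\<close>

lemma card_intermediate_hyperplane:
  assumes "sub S" "sub W" "S \<subseteq> W" "finite W" "card S = q ^ j" "card W = q ^ Suc t" "j \<le> t"
  shows "card (intermediate S t W) = gnum q (Suc t - j)"
  using assms(7,1,3,5)
proof (induction j arbitrary: S rule: inc_induct)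
  case base
  thus ?case using assms by (simp add: intermediate_self gnum_def Suc_diff_le)
next
  case (step j)
  have fin: "finite S" using step assms finite_subset by auto
  have *: "card (intermediate (adj S v) t W) = gnum q (t - j)" if "v \<in> W - S" for v
    using step.IH[of "adj S v"] that step.prems assms
    by (simp add: sub_adj adj_subset card_adj)
  have "card (intermediate S t W) * (q ^ t - q ^ j) = (q ^ Suc t - q ^ j) * gnum q (t - j)"
    (is "?N * _ = _")
    using double_count_intermediate[of S W j t] step.prems assms * fin
    by (simp add: card_Diff_subset)
  moreover have "q ^ n - q ^ j = q ^ j * ((q - 1) * gnum q (n - j))" if "j \<le> n" for n
  proof -
    have *: "q ^ n = q ^ j * q ^ (n - j)"
      using that by (simp flip: power_add)
    have "q ^ n - q ^ j = q ^ j * (q ^ (n - j) - 1)"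
      by (subst *) (simp only: diff_mult_distrib2 mult_1_right)
    thus ?thesis
      by (simp only: gnum_mult'[OF q_pos] mult.commute[of "q - 1"])
  qed
  from this[of t] this[of "Suc t"]
    have "q ^ t - q ^ j = q ^ j * ((q - 1) * gnum q (t - j))"
      "q ^ Suc t - q ^ j = q ^ j * ((q - 1) * gnum q (Suc t - j))"
    using step by simp_all
  moreover have "gnum q (t - j) > 0" using step by (simp add: gnum_pos)
  ultimately have "?N * (q ^ j * (q - 1) * gnum q (t - j)) =
      gnum q (Suc t - j) * (q ^ j * (q - 1) * gnum q (t - j))"
    by (simp only: mult_ac)
  thus ?case
    using \<open>gnum q (t - j) > 0\<close> q_ge_2 by (simp only: mult_cancel2) simp
qed

text \<open>The number is a Gaussian binomial coefficient; only its independence of \<open>S\<close>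
  is wanted, and the double count passes that on from \<open>j + 1\<close> to
  \<open>j\<close>.\<close>

lemma card_intermediate_const:
  assumes "sub W" "finite W" "card W = q ^ r" "j \<le> t"
  shows "\<exists>N. \<forall>S. sub S \<longrightarrow> S \<subseteq> W \<longrightarrow> card S = q ^ j \<longrightarrow> card (intermediate S t W) = N"
  using assms(4)
proof (induction j rule: inc_induct)
  case base
  thus ?case using assms by (auto simp: intermediate_self)
next
  case (step j)
  then obtain N where N: "\<And>S. sub S \<Longrightarrow> S \<subseteq> W \<Longrightarrow> card S = q ^ Suc j \<Longrightarrow> card (intermediate S t W) = N"
    by blast
  have "card (intermediate S t W) = (q ^ r - q ^ j) * N div (q ^ t - q ^ j)"
    if S: "sub S" "S \<subseteq> W" "card S = q ^ j" for S
  proof -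
    have *: "card (intermediate (adj S v) t W) = N" if "v \<in> W - S" for v
      using N[of "adj S v"] that S assms by (simp add: sub_adj adj_subset card_adj)
    have "q ^ j < q ^ t" using step q_ge_2 by simp
    moreover have "card (intermediate S t W) * (q ^ t - q ^ j) = (q ^ r - q ^ j) * N"
      using double_count_intermediate[of S W j t] S assms * finite_subset[of S W]
      by (simp add: card_Diff_subset)
    ultimately show ?thesis
      by (metis nonzero_mult_div_cancel_right zero_less_diff less_irrefl)
  qed
  thus ?case by blast
qed

section \<open>The lattice spanned by subspaces of fixed dimension\<close>

text \<open>The zero vector is included in the domain on purpose: the value at \<open>0\<close> is the sum of the
  coefficients.\<close>

definition subspace_lattice :: "nat \<Rightarrow> 'b set \<Rightarrow> ('b \<Rightarrow> int) set" where
  "subspace_lattice t V =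
     {f. \<exists>x. \<forall>v\<in>V. f v = (\<Sum>T\<in>intermediate {0} t V. x T * of_bool (v \<in> T))}"

lemma lattice_cong: "f \<in> subspace_lattice t V \<Longrightarrow> (\<And>v. v \<in> V \<Longrightarrow> f v = g v) \<Longrightarrow> g \<in> subspace_lattice t V"
  by (auto simp: subspace_lattice_def)

lemma lattice_add:
  assumes "f \<in> subspace_lattice t V" "g \<in> subspace_lattice t V"
  shows "(\<lambda>v. f v + g v) \<in> subspace_lattice t V"
proof -
  obtain x y where
    "\<forall>v\<in>V. f v = (\<Sum>T\<in>intermediate {0} t V. x T * of_bool (v \<in> T))"
    "\<forall>v\<in>V. g v = (\<Sum>T\<in>intermediate {0} t V. y T * of_bool (v \<in> T))"
    using assms by (auto simp: subspace_lattice_def)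
  thus ?thesis
    unfolding subspace_lattice_def
    by (intro CollectI exI[of _ "\<lambda>T. x T + y T"]) (simp only: distrib_right sum.distrib, simp)
qed

lemma lattice_scale:
  assumes "f \<in> subspace_lattice t V"
  shows "(\<lambda>v. c * f v) \<in> subspace_lattice t V"
proof -
  obtain x where "\<forall>v\<in>V. f v = (\<Sum>T\<in>intermediate {0} t V. x T * of_bool (v \<in> T))"
    using assms by (auto simp: subspace_lattice_def)
  thus ?thesis
    unfolding subspace_lattice_def
    by (intro CollectI exI[of _ "\<lambda>T. c * x T"]) (simp only: mult.assoc flip: sum_distrib_left, simp)
qed

lemma lattice_diff:
  "f \<in> subspace_lattice t V \<Longrightarrow> g \<in> subspace_lattice t V \<Longrightarrow>
   (\<lambda>v. f v - g v) \<in> subspace_lattice t V"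
  using lattice_add[OF _ lattice_scale[of g t V "- 1"], of f] by simp

lemma lattice_sum:
  assumes "\<And>i. i \<in> I \<Longrightarrow> f i \<in> subspace_lattice t V"
  shows "(\<lambda>v. \<Sum>i\<in>I. f i v) \<in> subspace_lattice t V"
proof (cases "finite I")
  case True
  thus ?thesis using assms
  proof (induction I)
    case empty
    show ?case by (auto simp: subspace_lattice_def intro: exI[of _ "\<lambda>_. 0"])
  next
    case (insert i I)
    thus ?case using lattice_add[of "f i" t V "\<lambda>v. \<Sum>i\<in>I. f i v"] by simp
  qed
next
  case False
  thus ?thesis by (auto simp: subspace_lattice_def intro: exI[of _ "\<lambda>_. 0"])
qed

lemma lattice_subspace:
  assumes "finite V" "T \<in> intermediate {0} t V"
  shows "(\<lambda>v. of_bool (v \<in> T)) \<in> subspace_lattice t V"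
proof -
  have "(\<Sum>T'\<in>intermediate {0} t V. of_bool (T' = T) * of_bool (v \<in> T')) = (of_bool (v \<in> T) :: int)" for v
  proof -
    have "(\<Sum>T'\<in>intermediate {0} t V. of_bool (T' = T) * of_bool (v \<in> T')) =
          (\<Sum>T'\<in>intermediate {0} t V. if T' = T then (of_bool (v \<in> T) :: int) else 0)"
      by (intro sum.cong) auto
    thus ?thesis using assms by (simp add: finite_intermediate)
  qed
  thus ?thesis unfolding subspace_lattice_def
    by (intro CollectI exI[of _ "\<lambda>T'. of_bool (T' = T)"]) simp
qed

section \<open>Congruences modulo the lattice\<close>

lemma sum_of_bool_mem:
  "finite \<T> \<Longrightarrow> (\<Sum>T\<in>\<T>. of_bool (v \<in> T)) = int (card {T \<in> \<T>. v \<in> T})"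
  by (simp add: Int_def)

text \<open>A vector of \<open>S\<close> lies in all \<open>[t - j] + q ^ (t - j)\<close>
  hyperplanes of \<open>W\<close> through \<open>S\<close>; a vector of \<open>W - S\<close> lies in
  the \<open>[t - j]\<close> ones through \<open>adj S v\<close>.\<close>

lemma card_intermediate_hyperplane_mem:
  assumes "finite W" "sub S" "sub W" "S \<subseteq> W" "card S = q ^ j" "card W = q ^ Suc t" "j \<le> t"
  shows "card {T \<in> intermediate S t W. v \<in> T} =
         q ^ (t - j) * of_bool (v \<in> S) + gnum q (t - j) * of_bool (v \<in> W)"
proof -
  have fin: "finite S" using assms(1,4) by (meson finite_subset)
  consider "v \<in> S" | "v \<in> W" "v \<notin> S" | "v \<notin> W" by blast
  thus ?thesis
  proof cases
    case 1
    hence *: "{T \<in> intermediate S t W. v \<in> T} = intermediate S t W"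
      by (auto simp: intermediate_def)
    show ?thesis
      using 1 card_intermediate_hyperplane[of S W j t] assms
      unfolding * by (auto simp: gnum_Suc Suc_diff_le)
  next
    case 2
    show ?thesis
    proof (cases "j = t")
      \<comment> \<open>Here \<open>adj S v\<close> is already \<open>W\<close>, outside the range
        of the hyperplane count; the only intermediate subspace is \<open>S\<close>.\<close>
      case True
      hence *: "{T \<in> intermediate S t W. v \<in> T} = {}"
        using 2 assms fin intermediate_self[of S W t] by auto
      show ?thesis using 2 True by (subst *) simp
    next
      case False
      thus ?thesis
        using 2 card_intermediate_hyperplane[of "adj S v" W "Suc j" t] assms
        by (simp add: sub_adj adj_subset card_adj intermediate_adj)
    qed
  next
    case 3
    hence *: "{T \<in> intermediate S t W. v \<in> T} = {}"
      by (auto simp: intermediate_def)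
    show ?thesis using 3 assms by (subst *) auto
  qed
qed

text \<open>The sum of the indicator functions of all hyperplanes of \<open>W\<close> through
  \<open>S\<close>.\<close>

lemma lattice_subspace_pair:
  assumes "finite V" "sub S" "sub W" "S \<subseteq> W" "W \<subseteq> V" "card S = q ^ j" "card W = q ^ Suc t" "j \<le> t"
  shows "(\<lambda>v. int q ^ (t - j) * of_bool (v \<in> S) + int (gnum q (t - j)) * of_bool (v \<in> W))
           \<in> subspace_lattice t V"
proof -
  have fin: "finite W" using assms(1,5) by (meson finite_subset)
  have "(\<lambda>v. \<Sum>T\<in>intermediate S t W. of_bool (v \<in> T)) \<in> subspace_lattice t V"
    by (intro lattice_sum lattice_subspace) (use assms in \<open>auto simp: intermediate_def sub_zero\<close>)
  moreover have "(\<Sum>T\<in>intermediate S t W. of_bool (v \<in> T)) =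
      int q ^ (t - j) * of_bool (v \<in> S) + int (gnum q (t - j)) * of_bool (v \<in> W)" for v
    using fin card_intermediate_hyperplane_mem[of W S j t v] assms
    by (simp add: sum_of_bool_mem finite_intermediate del: sum_of_bool_eq)
  ultimately show ?thesis
    by (simp only:)
qed

text \<open>The pairs for \<open>{0}\<close> and for a one-dimensional \<open>P\<close> in
  \<open>W \<inter> W'\<close> put \<open>[t]\<close> times and \<open>[t - 1]\<close> times the
  difference into the lattice, and \<open>[t] - q * [t - 1] = 1\<close>.\<close>

lemma lattice_subspace_diff:
  assumes "finite V" "sub S" "sub W" "sub W'" "S \<subseteq> W" "S \<subseteq> W'" "W \<subseteq> V" "W' \<subseteq> V"
    and "card S = q ^ t" "card W = q ^ Suc t" "card W' = q ^ Suc t" "1 \<le> t"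
  shows "(\<lambda>v. of_bool (v \<in> W) - of_bool (v \<in> W')) \<in> subspace_lattice t V"
proof -
  have "finite S" using assms(1,5,7) by (meson finite_subset)
  then obtain P where P: "sub P" "P \<subseteq> S" "card P = q ^ 1"
    using exists_sub_between[of "{0}" S 0 t 1] assms sub_singleton_zero sub_zero by auto
  have g: "int (gnum q t) = 1 + int q * int (gnum q (t - 1))"
    using gnum_Suc'[of q "t - 1"] assms by simp
  have "(\<lambda>v. int q ^ (t - 1) * of_bool (v \<in> P) + int (gnum q (t - 1)) * of_bool (v \<in> X))
           \<in> subspace_lattice t V"
    "(\<lambda>v. int q ^ (t - 0) * of_bool (v \<in> {0}) + int (gnum q (t - 0)) * of_bool (v \<in> X))
           \<in> subspace_lattice t V" if "X = W \<or> X = W'" for X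
    using that assms P sub_zero
    by (intro lattice_subspace_pair; auto simp: sub_singleton_zero)+
  note L = lattice_diff[OF lattice_diff[OF this(2)[of W] this(2)[of W']]
      lattice_scale[OF lattice_diff[OF this(1)[of W] this(1)[of W']], of "int q"]]
  show ?thesis
    by (rule lattice_cong[OF L]) (simp_all add: g algebra_simps)
qed

text \<open>The \<open>[h]\<close> subspaces of dimension \<open>t + 1\<close> through
  \<open>S\<close> cover each vector of \<open>V - S\<close> exactly once. Each is congruent to
  \<open>W\<close>, and the overlap is a multiple of the indicator of \<open>S\<close>, itself in
  the lattice.\<close>

lemma lattice_whole_space:
  assumes "sub V" "finite V" "card V = q ^ (t + h)" "sub S" "sub W" "S \<subseteq> W" "W \<subseteq> V"
    and "card S = q ^ t" "card W = q ^ Suc t" "1 \<le> t"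
  shows "(\<lambda>v. 1 - int (gnum q h) * of_bool (v \<in> W)) \<in> subspace_lattice t V"
proof -
  define \<A> where "\<A> = intermediate S (Suc t) V"
  have "S \<subseteq> V" using assms by blast
  hence fin: "finite \<A>" "finite S" "S \<subseteq> V"
    using assms(2) by (auto simp: \<A>_def finite_intermediate intro: finite_subset)
  have adj: "intermediate (adj S v) (Suc t) V = {adj S v}" if "v \<in> V - S" for v
    using that assms fin by (intro intermediate_self) (auto simp: sub_adj adj_subset card_adj)
  have "card \<A> * (q ^ Suc t - q ^ t) = q ^ (t + h) - q ^ t"
    using double_count_intermediate[of S V t "Suc t"] assms fin adj
    by (simp add: \<A>_def card_Diff_subset)
  also have "q ^ Suc t - q ^ t = q ^ t * (q - 1)"
    by (simp add: diff_mult_distrib2 mult.commute)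
  also have "q ^ (t + h) - q ^ t = q ^ t * (q ^ h - 1)"
    by (simp add: diff_mult_distrib2 power_add)
  also have "q ^ h - 1 = gnum q h * (q - 1)"
    by (simp only: gnum_mult'[OF q_pos])
  finally have "card \<A> * (q ^ t * (q - 1)) = gnum q h * (q ^ t * (q - 1))"
    by (simp only: mult_ac)
  hence card_\<A>: "card \<A> = gnum q h"
    using q_ge_2 by (simp only: mult_cancel2) simp
  have count: "(\<Sum>W'\<in>\<A>. of_bool (v \<in> W')) = 1 + (int (gnum q h) - 1) * of_bool (v \<in> S)"
    if "v \<in> V" for v
  proof (cases "v \<in> S")
    case True
    hence "{W' \<in> \<A>. v \<in> W'} = \<A>"
      by (auto simp: \<A>_def intermediate_def)
    thus ?thesis using True fin card_\<A> by (simp add: sum_of_bool_mem del: sum_of_bool_eq)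
  next
    case False
    hence "{W' \<in> \<A>. v \<in> W'} = {adj S v}"
      using that adj[of v] assms by (simp add: \<A>_def intermediate_adj)
    thus ?thesis using False fin by (simp add: sum_of_bool_mem del: sum_of_bool_eq)
  qed
  have "(\<lambda>v. of_bool (v \<in> S)) \<in> subspace_lattice t V"
    by (intro lattice_subspace) (use assms in \<open>auto simp: intermediate_def sub_zero\<close>)
  moreover have "(\<lambda>v. \<Sum>W'\<in>\<A>. of_bool (v \<in> W') - of_bool (v \<in> W)) \<in> subspace_lattice t V"
    by (rule lattice_sum, rule lattice_subspace_diff[where S = S])
      (use assms in \<open>auto simp: \<A>_def intermediate_def\<close>)
  ultimately have L: "(\<lambda>v. (\<Sum>W'\<in>\<A>. of_bool (v \<in> W') - of_bool (v \<in> W)) -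
      (int (gnum q h) - 1) * of_bool (v \<in> S)) \<in> subspace_lattice t V"
    by (intro lattice_diff lattice_scale)
  show ?thesis
  proof (rule lattice_cong[OF L])
    fix v assume "v \<in> V"
    have "(\<Sum>W'\<in>\<A>. of_bool (v \<in> W') - of_bool (v \<in> W)) =
        (\<Sum>W'\<in>\<A>. of_bool (v \<in> W')) - int (gnum q h) * of_bool (v \<in> W)"
      by (simp add: sum_subtractf card_\<A> del: sum_of_bool_eq)
    thus "(\<Sum>W'\<in>\<A>. of_bool (v \<in> W') - of_bool (v \<in> W)) -
        (int (gnum q h) - 1) * of_bool (v \<in> S) = 1 - int (gnum q h) * of_bool (v \<in> W)"
      using count[OF \<open>v \<in> V\<close>] by (simp add: algebra_simps del: sum_of_bool_eq)
  qed
qed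

section \<open>Multiplicities of the kernels, first integral, then nonnegative\<close>

text \<open>\<open>x\<close> consists of the coefficients of the function \<open>f\<close> of the
  overview. It is at most \<open>e\<close> at nonzero vectors, because \<open>\<epsilon>\<close> and
  \<open>a\<close> are nonnegative and the term with \<open>s + a\<close> lives at \<open>0\<close>
  alone.\<close>

lemma virtual_multiplicities:
  fixes s a e :: int
  assumes "sub V" "finite V" "card V = q ^ (t + h)" "1 \<le> t" "1 \<le> h"
    and "\<And>l. 0 \<le> \<epsilon> l" "0 \<le> a"
    and e: "e * int (gnum q h) = a + s * int (gnum q t) - (\<Sum>l<t. \<epsilon> l * int (gnum q l))"
    and d: "d = s * int q ^ t - (\<Sum>l<t. \<epsilon> l * int q ^ l)"
  shows "\<exists>x :: 'b set \<Rightarrow> int. (\<Sum>T\<in>intermediate {0} t V. x T) = d + e \<and>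
           (\<forall>v\<in>V - {0}. (\<Sum>T\<in>intermediate {0} t V. x T * of_bool (v \<in> T)) \<le> e)"
proof -
  obtain W where W: "sub W" "W \<subseteq> V" "card W = q ^ Suc t"
    using exists_sub_between[of "{0}" V 0 "t + h" "Suc t"] assms sub_singleton_zero sub_zero by auto
  have "finite W" using W(2) assms(2) by (meson finite_subset)
  hence "\<exists>S. sub S \<and> S \<subseteq> W \<and> card S = q ^ j" if "j \<le> t" for j
    using exists_sub_between[of "{0}" W 0 "Suc t" j] that W sub_singleton_zero sub_zero by auto
  then obtain S where S: "\<And>j. j \<le> t \<Longrightarrow> sub (S j) \<and> S j \<subseteq> W \<and> card (S j) = q ^ j"
    by metis
  have pair: "(\<lambda>v. int q ^ l * of_bool (v \<in> S (t - l)) + int (gnum q l) * of_bool (v \<in> W))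
      \<in> subspace_lattice t V" if "l \<le> t" for l
    using lattice_subspace_pair[of V "S (t - l)" W "t - l" t] that S[of "t - l"] W assms by simp
  have zero: "(\<lambda>v. int q ^ t * of_bool (v = 0) + int (gnum q t) * of_bool (v \<in> W))
      \<in> subspace_lattice t V"
    using lattice_subspace_pair[of V "{0}" W 0 t] W assms sub_singleton_zero sub_zero by simp
  have whole: "(\<lambda>v. 1 - int (gnum q h) * of_bool (v \<in> W)) \<in> subspace_lattice t V"
    using lattice_whole_space[of V t h "S t" W] S[of t] W assms by simp
  define f where "f v = e - (\<Sum>l<t. \<epsilon> l * int q ^ l * of_bool (v \<in> S (t - l)))
      - a * int q ^ t * of_bool (v \<in> S 1) + (s + a) * int q ^ t * of_bool (v = 0)" for v
  \<comment> \<open>Each term of \<open>f\<close> is completed to a lattice member by a multiple of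
    the indicator of \<open>W\<close>. The term with \<open>a\<close> is \<open>q\<close> times the
    pair for \<open>l = t - 1\<close>, whence the unreduced \<open>t - (t - 1)\<close>.\<close>
  have L: "(\<lambda>v. e * (1 - int (gnum q h) * of_bool (v \<in> W))
      - (\<Sum>l<t. \<epsilon> l * (int q ^ l * of_bool (v \<in> S (t - l)) + int (gnum q l) * of_bool (v \<in> W)))
      - a * int q * (int q ^ (t - 1) * of_bool (v \<in> S (t - (t - 1))) + int (gnum q (t - 1)) * of_bool (v \<in> W))
      + (s + a) * (int q ^ t * of_bool (v = 0) + int (gnum q t) * of_bool (v \<in> W)))
      \<in> subspace_lattice t V"
    by (intro lattice_add lattice_diff lattice_sum lattice_scale whole pair zero) auto
  have "f \<in> subspace_lattice t V"
  proof (rule lattice_cong[OF L])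
    fix v
    let ?w = "of_bool (v \<in> W) :: int"
    have g: "int (gnum q t) = 1 + int q * int (gnum q (t - 1))"
      and p: "int q ^ t = int q * int q ^ (t - 1)" and "t - (t - 1) = 1"
      using gnum_Suc'[of q "t - 1"] assms by (simp_all flip: power_Suc)
    \<comment> \<open>The total coefficient of the indicator of \<open>W\<close>; it vanishes by the
      hypothesis on \<open>e\<close> and \<open>[t] = 1 + q * [t - 1]\<close>.\<close>
    have "(- e * int (gnum q h) - (\<Sum>l<t. \<epsilon> l * int (gnum q l))
        - a * int q * int (gnum q (t - 1)) + (s + a) * int (gnum q t)) = 0"
      using e by (simp add: g algebra_simps)
    hence "(- e * int (gnum q h) - (\<Sum>l<t. \<epsilon> l * int (gnum q l))
        - a * int q * int (gnum q (t - 1)) + (s + a) * int (gnum q t)) * ?w = 0"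
      by simp
    moreover have "(\<Sum>l<t. \<epsilon> l * (int q ^ l * of_bool (v \<in> S (t - l)) + int (gnum q l) * ?w)) =
        (\<Sum>l<t. \<epsilon> l * int q ^ l * of_bool (v \<in> S (t - l))) + (\<Sum>l<t. \<epsilon> l * int (gnum q l)) * ?w"
      by (simp only: distrib_left sum.distrib sum_distrib_right mult.assoc)
    moreover note \<open>t - (t - 1) = 1\<close>
    moreover have "a * int q ^ t * of_bool (v \<in> S 1) = a * int q * int q ^ (t - 1) * of_bool (v \<in> S 1)"
      by (simp add: p)
    ultimately show "e * (1 - int (gnum q h) * of_bool (v \<in> W))
      - (\<Sum>l<t. \<epsilon> l * (int q ^ l * of_bool (v \<in> S (t - l)) + int (gnum q l) * of_bool (v \<in> W)))
      - a * int q * (int q ^ (t - 1) * of_bool (v \<in> S (t - (t - 1))) + int (gnum q (t - 1)) * of_bool (v \<in> W))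
      + (s + a) * (int q ^ t * of_bool (v = 0) + int (gnum q t) * of_bool (v \<in> W)) = f v"
      unfolding f_def by (simp only: algebra_simps)
  qed
  then obtain x where x: "\<And>v. v \<in> V \<Longrightarrow> f v = (\<Sum>T\<in>intermediate {0} t V. x T * of_bool (v \<in> T))"
    by (auto simp: subspace_lattice_def)
  have "0 \<in> V" using assms sub_zero by blast
  have "f 0 = (\<Sum>T\<in>intermediate {0} t V. x T)"
    unfolding x[OF \<open>0 \<in> V\<close>] by (intro sum.cong) (auto simp: intermediate_def)
  moreover have "(\<Sum>l<t. \<epsilon> l * int q ^ l * of_bool (0 \<in> S (t - l))) = (\<Sum>l<t. \<epsilon> l * int q ^ l)"
    using S sub_zero by (intro sum.cong) auto
  hence "f 0 = d + e"
    using S[of 1] sub_zero[of "S 1"] assms by (simp add: f_def algebra_simps)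
  moreover have "f v \<le> e" if "v \<noteq> 0" for v
  proof -
    have "0 \<le> (\<Sum>l<t. \<epsilon> l * int q ^ l * of_bool (v \<in> S (t - l)))"
      by (intro sum_nonneg) (simp add: assms)
    moreover have "0 \<le> a * int q ^ t * of_bool (v \<in> S 1)" using assms by simp
    ultimately show ?thesis using that by (simp add: f_def)
  qed
  ultimately show ?thesis
    using x by (intro exI[of _ x]) (metis DiffE singletonI)
qed

text \<open>Adding all \<open>t\<close>-subspaces equally removes negative multiplicities and
  changes \<open>d\<close> by a multiple of the period \<open>p\<close>. So one virtual solution for
  each residue modulo \<open>p\<close> covers all large \<open>d\<close>.\<close>

lemma subspace_multiplicities:
  assumes "sub V" "finite V" "card V = q ^ (t + h)" "1 \<le> t" "1 \<le> h"
  shows "\<exists>D. \<forall>d\<ge>D. \<exists>m :: 'b set \<Rightarrow> nat.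
           (\<Sum>T\<in>intermediate {0} t V. int (m T)) = int d + excess q h t (int d) \<and>
           (\<forall>v\<in>V - {0}. (\<Sum>T\<in>intermediate {0} t V. int (m T) * of_bool (v \<in> T)) \<le> excess q h t (int d))"
proof -
  define \<T> where "\<T> = intermediate {0} t V"
  have fin: "finite \<T>" using assms by (simp add: \<T>_def finite_intermediate)
  have "0 \<in> V" using assms sub_zero by blast
  define N where "N = card \<T>"
  obtain \<mu> where "\<And>S. sub S \<Longrightarrow> S \<subseteq> V \<Longrightarrow> card S = q ^ 1 \<Longrightarrow> card (intermediate S t V) = \<mu>"
    using card_intermediate_const[of V "t + h" 1 t] assms by blast
  hence \<mu>': "card (intermediate (adj {0} v) t V) = \<mu>" if "v \<in> V - {0}" for v
    using that assms \<open>0 \<in> V\<close> by (auto simp: sub_adj sub_singleton_zero adj_subset card_adj)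
  hence \<mu>: "card {T \<in> \<T>. v \<in> T} = \<mu>" if "v \<in> V - {0}" for v
    using that by (simp add: \<T>_def intermediate_adj sub_singleton_zero)
  have "N * (q ^ t - 1) = (q ^ (t + h) - 1) * \<mu>"
    using double_count_intermediate[of "{0}" V 0 t] assms \<mu>' \<open>0 \<in> V\<close> sub_singleton_zero
    by (simp add: N_def \<T>_def)
  hence "N * gnum q t * (q - 1) = \<mu> * gnum q (t + h) * (q - 1)"
    by (simp only: gnum_mult'[OF q_pos, symmetric] mult_ac)
  hence N: "N * gnum q t = \<mu> * gnum q (t + h)"
    using q_ge_2 by simp
  have "\<T> \<noteq> {}"
    using exists_sub_between[of "{0}" V 0 "t + h" t] assms \<open>0 \<in> V\<close> sub_singleton_zero
    by (auto simp: \<T>_def intermediate_def)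
  hence "0 < N" using fin by (simp add: N_def card_gt_0_iff)
  have "\<mu> < N"
  proof (rule ccontr)
    assume "\<not> \<mu> < N"
    have "gnum q t < gnum q (t + h)"
      using gnum_pos[of h q] q_pos assms by (simp add: gnum_add)
    hence "N * gnum q t < N * gnum q (t + h)" using \<open>0 < N\<close> by simp
    also have "\<dots> \<le> \<mu> * gnum q (t + h)" using \<open>\<not> \<mu> < N\<close> by simp
    finally show False using N by simp
  qed
  \<comment> \<open>There are \<open>N\<close> subspaces, \<open>\<mu>\<close> of them through each
    nonzero vector; this is the relation that \<open>excess_shift\<close> requires.\<close>
  have shift: "(N - \<mu>) * gnum q t = (\<mu> * q ^ t) * gnum q h"
    using N unfolding gnum_add by (simp add: diff_mult_distrib algebra_simps)
  define p where "p = q ^ t * (N - \<mu>)"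
  have "0 < p" using \<open>\<mu> < N\<close> q_pos by (simp add: p_def)

  define good where "good d m \<longleftrightarrow>
      (\<Sum>T\<in>\<T>. int (m T)) = int d + excess q h t (int d) \<and>
      (\<forall>v\<in>V - {0}. (\<Sum>T\<in>\<T>. int (m T) * of_bool (v \<in> T)) \<le> excess q h t (int d))"
    for d and m :: "'b set \<Rightarrow> nat"
  have "\<exists>c0. \<forall>c\<ge>c0. \<exists>m. good (\<rho> + c * p) m" for \<rho>
  proof -
    obtain s \<epsilon> where s: "\<And>l. 0 \<le> \<epsilon> l" "int \<rho> = s * int q ^ t - (\<Sum>l<t. \<epsilon> l * int q ^ l)"
        "ceil_sum q t (int \<rho>) = s * int (gnum q t) - (\<Sum>l<t. \<epsilon> l * int (gnum q l))"
      using ceil_sum_digits[OF q_pos, of "int \<rho>" t] by blast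
    define e where "e = excess q h t (int \<rho>)"
    \<comment> \<open>The slack of the outer ceiling.\<close>
    define a where "a = e * int (gnum q h) - ceil_sum q t (int \<rho>)"
    have "0 \<le> a"
      using excess_ge[of h q t "int \<rho>"] assms by (simp add: a_def e_def)
    have e: "e * int (gnum q h) = a + s * int (gnum q t) - (\<Sum>l<t. \<epsilon> l * int (gnum q l))"
      unfolding a_def s(3) by simp
    obtain x where x: "(\<Sum>T\<in>\<T>. x T) = int \<rho> + e"
        "\<And>v. v \<in> V - {0} \<Longrightarrow> (\<Sum>T\<in>\<T>. x T * of_bool (v \<in> T)) \<le> e"
      using virtual_multiplicities[OF assms s(1) \<open>0 \<le> a\<close> e s(2)] unfolding \<T>_def
      by blast
    \<comment> \<open>A crude common bound for all \<open>\<bar>x T\<bar>\<close>.\<close>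
    define c0 where "c0 = nat (\<Sum>T\<in>\<T>. \<bar>x T\<bar>)"
    have nonneg: "0 \<le> x T + int q ^ t * int c" if "c \<ge> c0" "T \<in> \<T>" for c T
    proof -
      have "\<bar>x T\<bar> \<le> (\<Sum>T\<in>\<T>. \<bar>x T\<bar>)"
        using fin that by (intro member_le_sum) auto
      also have "\<dots> \<le> int c" using that by (simp add: c0_def)
      also have "\<dots> \<le> int q ^ t * int c"
        using mult_right_mono[of 1 "int q ^ t" "int c"] q_pos by simp
      finally show ?thesis by linarith
    qed
    have "good (\<rho> + c * p) (\<lambda>T. nat (x T + int q ^ t * int c))" if "c \<ge> c0" for c
    proof -
      have ex: "excess q h t (int (\<rho> + c * p)) = e + int c * int (\<mu> * q ^ t)"
        unfolding e_def p_def
        using excess_shift[OF q_pos _ shift, of "int \<rho>" c] assms by (simp add: mult_ac)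
      have "(\<Sum>T\<in>\<T>. x T + int q ^ t * int c) = int \<rho> + e + int N * (int q ^ t * int c)"
        by (simp add: sum.distrib x N_def)
      also have "int N * (int q ^ t * int c) = int (c * p) + int c * int (\<mu> * q ^ t)"
        using \<open>\<mu> < N\<close> by (simp add: p_def of_nat_diff algebra_simps)
      finally have "(\<Sum>T\<in>\<T>. x T + int q ^ t * int c) = int (\<rho> + c * p) + excess q h t (int (\<rho> + c * p))"
        unfolding ex by simp
      moreover have "(\<Sum>T\<in>\<T>. (x T + int q ^ t * int c) * of_bool (v \<in> T)) \<le> excess q h t (int (\<rho> + c * p))"
        if "v \<in> V - {0}" for v
      proof -
        have "(\<Sum>T\<in>\<T>. of_bool (v \<in> T)) = int \<mu>"
          using fin \<mu>[OF that] by (simp add: sum_of_bool_mem del: sum_of_bool_eq)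
        hence "(\<Sum>T\<in>\<T>. (x T + int q ^ t * int c) * of_bool (v \<in> T)) =
            (\<Sum>T\<in>\<T>. x T * of_bool (v \<in> T)) + int q ^ t * int c * int \<mu>"
          by (simp only: distrib_right sum.distrib flip: sum_distrib_left)
        thus ?thesis using x(2)[OF that] unfolding ex by simp
      qed
      ultimately show ?thesis
        using nonneg[OF \<open>c \<ge> c0\<close>] unfolding good_def by simp
    qed
    thus ?thesis by blast
  qed
  then obtain c0 where c0: "\<And>\<rho> c. c0 \<rho> \<le> c \<Longrightarrow> \<exists>m. good (\<rho> + c * p) m"
    by metis
  \<comment> \<open>The sum dominates the thresholds of all residues at once.\<close>
  have "\<exists>m. good d m" if "d \<ge> p * (\<Sum>\<rho><p. c0 \<rho>)" for d
  proof -
    have "c0 (d mod p) \<le> (\<Sum>\<rho><p. c0 \<rho>)"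
      using \<open>0 < p\<close> by (intro member_le_sum) auto
    also have "\<dots> \<le> d div p"
      using div_le_mono[OF that, of p] \<open>0 < p\<close> by simp
    finally show ?thesis
      using c0[of "d mod p" "d div p"] by simp
  qed
  thus ?thesis
    unfolding good_def \<T>_def by blast
qed

section \<open>Linear maps into the alphabet with prescribed kernel\<close>

text \<open>The map is extended along a chain of subspaces from \<open>T\<close> to
  \<open>V\<close>: a new vector \<open>v\<close> goes to a value \<open>w\<close> outside the image
  so far, which keeps the kernel equal to \<open>T\<close>. The bound on the image size guarantees
  such a \<open>w\<close> in the induction.\<close>

lemma linear_map_with_kernel:
  assumes "sub T" "sub V" "finite V" "T \<subseteq> V" "card T = q ^ t" "card V = q ^ (t + h)"
    and "q ^ h \<le> CARD('a)"
  shows "\<exists>\<phi> :: 'b \<Rightarrow> 'a. (\<forall>x\<in>V. \<forall>y\<in>V. \<phi> (x + y) = \<phi> x + \<phi> y) \<and>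
           (\<forall>c\<in>K. \<forall>x\<in>V. \<phi> (c *s x) = c * \<phi> x) \<and> (\<forall>x\<in>V. \<phi> x = 0 \<longleftrightarrow> x \<in> T) \<and>
           card (\<phi> ` V) \<le> q ^ h"
  using assms
proof (induction h arbitrary: V)
  case 0
  hence "T = V" by (simp add: card_subset_eq)
  have "card ((\<lambda>_. 0 :: 'a) ` V) \<le> card {0 :: 'a}"
    by (rule card_mono) auto
  thus ?case
    using \<open>T = V\<close> by (intro exI[of _ "\<lambda>_. 0"]) simp
next
  case (Suc h)
  obtain U where U: "sub U" "T \<subseteq> U" "U \<subseteq> V" "card U = q ^ (t + h)"
    using exists_sub_between[of T V t "t + Suc h" "t + h"] Suc.prems by auto
  have finU: "finite U" using U(3) Suc.prems(3) by (rule finite_subset)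
  have "q ^ h < q ^ Suc h" using q_ge_2 by simp
  hence "q ^ h \<le> CARD('a)" using Suc.prems(7) by linarith
  obtain \<psi> :: "'b \<Rightarrow> 'a" where
    add: "\<And>x y. x \<in> U \<Longrightarrow> y \<in> U \<Longrightarrow> \<psi> (x + y) = \<psi> x + \<psi> y" and
    scale: "\<And>c x. c \<in> K \<Longrightarrow> x \<in> U \<Longrightarrow> \<psi> (c *s x) = c * \<psi> x" and
    ker: "\<And>x. x \<in> U \<Longrightarrow> \<psi> x = 0 \<longleftrightarrow> x \<in> T" and
    im: "card (\<psi> ` U) \<le> q ^ h"
    using Suc.IH[OF Suc.prems(1) U(1) finU U(2) Suc.prems(5) U(4) \<open>q ^ h \<le> CARD('a)\<close>]
    by blast
  have "card U < card V"
    using U Suc.prems q_ge_2 by simp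
  then obtain v where v: "v \<in> V" "v \<notin> U"
    using U by (metis less_irrefl subset_antisym subsetI)
  have V: "V = adj U v"
    using Suc.prems U v
    by (intro card_subset_eq[symmetric] adj_subset) (simp_all add: card_adj)
  have "card (\<psi> ` U) < CARD('a)"
    using im \<open>q ^ h < q ^ Suc h\<close> Suc.prems(7) by linarith
  then obtain w where w: "w \<notin> \<psi> ` U" by (metis UNIV_eq_I less_irrefl)
  \<comment> \<open>The coefficient of \<open>v\<close> in \<open>x\<close>, unique since
    \<open>v \<notin> U\<close>.\<close>
  define co where "co x = (SOME c. c \<in> K \<and> x - c *s v \<in> U)" for x
  have co: "co (s + c *s v) = c" if "s \<in> U" "c \<in> K" for s c
    unfolding co_def
  proof (rule some_equality)
    show "c \<in> K \<and> s + c *s v - c *s v \<in> U" using that by simp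
  next
    fix c' assume c': "c' \<in> K \<and> s + c *s v - c' *s v \<in> U"
    hence "s + c *s v - c' *s v - s \<in> U"
      using that c' U(1) by (intro sub_diff[of U _ s]) auto
    hence "(c - c') *s v \<in> U" by (simp add: scale_left_diff_distrib algebra_simps)
    thus "c' = c"
      using sub_scaleD[OF U(1), of "c - c'" v] v c' that diff_K by auto
  qed
  define \<phi> where "\<phi> x = \<psi> (x - co x *s v) + co x * w" for x
  have \<phi>: "\<phi> (s + c *s v) = \<psi> s + c * w" if "s \<in> U" "c \<in> K" for s c
    using that by (simp add: \<phi>_def co)
  have split: "\<exists>s\<in>U. \<exists>c\<in>K. x = s + c *s v" if "x \<in> V" for x
    using that unfolding V by (auto simp: adj_def)
  show ?case
  proof (intro exI[of _ \<phi>] conjI ballI)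
    fix x y assume "x \<in> V" "y \<in> V"
    then obtain s c s' c' where 1: "s \<in> U" "c \<in> K" "s' \<in> U" "c' \<in> K"
        "x = s + c *s v" "y = s' + c' *s v"
      using split by metis
    have "x + y = (s + s') + (c + c') *s v"
      using 1 by (simp add: scale_left_distrib add_ac)
    thus "\<phi> (x + y) = \<phi> x + \<phi> y"
      using 1(1-4) U(1) unfolding 1(5,6)
      by (simp only: \<phi> sub_add add_K add) (simp add: algebra_simps)
  next
    fix a x assume "a \<in> K" "x \<in> V"
    then obtain s c where 1: "s \<in> U" "c \<in> K" "x = s + c *s v"
      using split by metis
    have "a *s x = a *s s + (a * c) *s v"
      using 1 by (simp add: scale_right_distrib)
    thus "\<phi> (a *s x) = a * \<phi> x"
      using 1(1,2) U(1) \<open>a \<in> K\<close> unfolding 1(3)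
      by (simp only: \<phi> sub_scale mult_K scale) (simp add: algebra_simps)
  next
    fix x assume "x \<in> V"
    then obtain s c where 1: "s \<in> U" "c \<in> K" "x = s + c *s v"
      using split by metis
    show "\<phi> x = 0 \<longleftrightarrow> x \<in> T"
    proof (cases "c = 0")
      case True
      thus ?thesis using 1 ker \<phi>[of s 0] by simp
    next
      case False
      have "\<phi> x \<noteq> 0"
      proof
        assume "\<phi> x = 0"
        hence "\<psi> s = - c * w" using 1 \<phi> by (simp add: eq_neg_iff_add_eq_0)
        hence "w = (- inverse c) * \<psi> s" using False by (simp add: field_simps)
        also have "\<dots> = \<psi> ((- inverse c) *s s)"
          using 1 by (intro scale[symmetric] uminus_K inverse_K)
        also have "\<dots> \<in> \<psi> ` U"
          using 1 U(1) by (intro imageI sub_scale uminus_K inverse_K)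
        finally show False using w by simp
      qed
      moreover have "x \<notin> U"
      proof
        assume "x \<in> U"
        hence "x - s \<in> U" using 1 U(1) by (intro sub_diff)
        thus False using sub_scaleD[OF U(1), of c v] 1 v False by simp
      qed
      ultimately show ?thesis using U(2) by auto
    qed
  next
    have "\<phi> ` V \<subseteq> (\<lambda>(x, c). x + c * w) ` (\<psi> ` U \<times> K)"
    proof
      fix y assume "y \<in> \<phi> ` V"
      then obtain s c where "s \<in> U" "c \<in> K" "y = \<psi> s + c * w"
        using split \<phi> by (metis imageE)
      thus "y \<in> (\<lambda>(x, c). x + c * w) ` (\<psi> ` U \<times> K)" by auto
    qed
    hence "card (\<phi> ` V) \<le> card (\<psi> ` U \<times> K)"
      using finU finite_K by (intro surj_card_le) auto
    also have "\<dots> \<le> q ^ Suc h"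
      using im by (simp add: card_cartesian_product card_K)
    finally show "card (\<phi> ` V) \<le> q ^ Suc h" .
  qed
qed

section \<open>The Griesmer bound\<close>

text \<open>The residual code is never formed: passing from the subspace \<open>Z\<close> to the span of \<open>Z\<close> and a
  minimum weight word \<open>c\<close>, and to those coordinates \<open>i\<close> with \<open>c \<in> M i\<close>, has the same effect.\<close>

lemma griesmer:
  assumes "finite I" "finite V" "sub V" "sub Z" "Z \<subseteq> V" "card V = q ^ r * card Z"
    and "\<And>i. i \<in> I \<Longrightarrow> sub (M i) \<and> Z \<subseteq> M i"
    and "\<And>i c. i \<in> I \<Longrightarrow> c \<in> V - M i \<Longrightarrow> V \<subseteq> adj (M i) c"
    and "\<And>v. v \<in> V - Z \<Longrightarrow> D \<le> card {i \<in> I. v \<notin> M i}"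
  shows "griesmer_sum q r D \<le> int (card I)"
  using assms(1,4-)
proof (induction r arbitrary: Z D I)
  case 0
  show ?case by (simp add: griesmer_sum_def)
next
  case (Suc r)
  \<comment> \<open>\<open>M i\<close> plays the kernel of coordinate \<open>i\<close>, which makes
    \<open>wt\<close> the Hamming weight.\<close>
  define wt where "wt v = card {i \<in> I. v \<notin> M i}" for v
  have finZ: "finite Z" using Suc.prems(3) assms(2) by (rule finite_subset)
  have "card Z > 0"
    using finZ sub_zero[OF Suc.prems(2)] by (auto simp: card_gt_0_iff)
  have "card Z < card V"
    using Suc.prems(4) one_less_power[of q "Suc r"] q_ge_2 \<open>card Z > 0\<close> by simp
  hence "V - Z \<noteq> {}"
    using Suc.prems(3) by (metis Diff_eq_empty_iff less_irrefl subset_antisym)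
  then obtain c where c: "c \<in> V - Z" "\<And>v. v \<in> V - Z \<Longrightarrow> wt c \<le> wt v"
    using ex_has_least_nat[of "\<lambda>v. v \<in> V - Z" _ wt] by (metis all_not_in_conv)
  define I' where "I' = {i \<in> I. c \<in> M i}"
  define D' where "D' = nat (- (- int D div int q))"
  have finI': "finite I'" using Suc.prems(1) by (simp add: I'_def)
  have cV: "c \<in> V" and cZ: "c \<notin> Z" using c by auto
  have "griesmer_sum q r D' \<le> int (card I')"
  proof (rule Suc.IH[of I' "adj Z c"])
    show "finite I'" by fact
    show "sub (adj Z c)" using Suc.prems by (simp add: sub_adj)
    show "adj Z c \<subseteq> V" using Suc.prems assms cV by (intro adj_subset)
    show "card V = q ^ r * card (adj Z c)"
      using Suc.prems cZ by (simp add: card_adj)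
    show "sub (M i) \<and> adj Z c \<subseteq> M i" if "i \<in> I'" for i
      using that Suc.prems(5)[of i] adj_subset[of "M i" Z c] by (simp add: I'_def)
    show "V \<subseteq> adj (M i) b" if "i \<in> I'" "b \<in> V - M i" for i b
      using that Suc.prems(6) by (simp add: I'_def)
    show "D' \<le> card {i \<in> I'. v \<notin> M i}" if v: "v \<in> V - adj Z c" for v
    proof -
      have outside: "v + a *s c \<in> V - Z" if "a \<in> K" for a
      proof -
        have "v = (v + a *s c) + (- a) *s c" by simp
        hence "v + a *s c \<notin> Z"
          using v adjI[of "v + a *s c" Z "- a" c] uminus_K[OF that] by auto
        thus ?thesis using v cV that assms(3) by (auto intro!: sub_add sub_scale)
      qed
      \<comment> \<open>Along the words \<open>v + a c\<close>, a coordinate of \<open>I'\<close> is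
        always zero or never zero; any other vanishes for exactly one \<open>a\<close>, since
        \<open>v\<close> lies in \<open>adj (M i) c\<close>.\<close>
      have inside: "card {a \<in> K. v + a *s c \<notin> M i} =
          (if i \<in> I' then q * of_bool (v \<notin> M i) else q - 1)" if "i \<in> I" for i
      proof (cases "i \<in> I'")
        case True
        hence "v + a *s c \<in> M i \<longleftrightarrow> v \<in> M i" if "a \<in> K" for a
          using Suc.prems(5)[OF \<open>i \<in> I\<close>] that sub_diff[of "M i" "v + a *s c" "a *s c"]
          by (auto simp: I'_def intro: sub_add sub_scale)
        hence "{a \<in> K. v + a *s c \<notin> M i} = (if v \<in> M i then {} else K)" by auto
        thus ?thesis using True by (simp add: card_K)
      next
        case False
        hence cM: "c \<in> V - M i" using that cV by (simp add: I'_def)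
        have M: "sub (M i)" using Suc.prems(5)[OF that] by simp
        obtain w b where wb: "w \<in> M i" "b \<in> K" "v = w + b *s c"
          using Suc.prems(6)[OF \<open>i \<in> I\<close> cM] v by (auto simp: adj_def)
        have "v + a *s c \<in> M i \<longleftrightarrow> a = - b" if "a \<in> K" for a
        proof
          assume "v + a *s c \<in> M i"
          hence "(v + a *s c) - w \<in> M i" using wb M by (intro sub_diff)
          hence "(a + b) *s c \<in> M i" by (simp add: wb scale_left_distrib add_ac)
          thus "a = - b"
            using sub_scaleD[OF M, of "a + b" c] cM add_K that wb by (auto simp: add_eq_0_iff2)
        qed (use wb in simp)
        hence "{a \<in> K. v + a *s c \<notin> M i} = K - {- b}" by auto
        thus ?thesis using False wb finite_K by (simp add: card_K uminus_K)
      qed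
      have cardI: "card (I - I') = wt c"
        unfolding wt_def I'_def by (rule arg_cong[of _ _ card]) auto
      \<comment> \<open>Minimality of \<open>c\<close> gives
        \<open>q * wt c \<le> q * w + (q - 1) * wt c\<close>, where \<open>w\<close> is the weight
        of \<open>v\<close> on \<open>I'\<close>; hence
        \<open>w \<ge> wt c / q \<ge> D / q\<close>.\<close>
      have "q * wt c = (\<Sum>a\<in>K. wt c)" by (simp add: card_K)
      also have "\<dots> \<le> (\<Sum>a\<in>K. wt (v + a *s c))"
        using outside c(2) by (intro sum_mono) auto
      also have "\<dots> = (\<Sum>i\<in>I. if i \<in> I' then q * of_bool (v \<notin> M i) else q - 1)"
        unfolding wt_def using inside Suc.prems(1) finite_K by (intro sum_multicount_gen) auto
      also have "\<dots> = (\<Sum>i\<in>I'. q * of_bool (v \<notin> M i)) + (\<Sum>i\<in>I - I'. q - 1)"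
        using Suc.prems(1) by (subst sum.If_cases) (auto simp: I'_def Int_def Diff_eq intro!: arg_cong2[of _ _ _ _ "(+)"] sum.cong)
      also have "\<dots> = q * card {i \<in> I'. v \<notin> M i} + wt c * (q - 1)"
        using finI' by (simp add: cardI Int_def flip: sum_distrib_left)
      finally have "wt c + wt c * (q - 1) \<le> q * card {i \<in> I'. v \<notin> M i} + wt c * (q - 1)"
        using q_pos by (cases q) auto
      hence "wt c \<le> q * card {i \<in> I'. v \<notin> M i}" by simp
      hence "D \<le> q * card {i \<in> I'. v \<notin> M i}"
        using Suc.prems(7)[OF c(1)] by (simp add: wt_def)
      hence "int D \<le> int (card {i \<in> I'. v \<notin> M i}) * int q"
        by (simp add: mult.commute flip: of_nat_mult)
      hence "- int (card {i \<in> I'. v \<notin> M i}) * int q \<le> - int D" by simp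
      hence "- int (card {i \<in> I'. v \<notin> M i}) * int q div int q \<le> - int D div int q"
        using q_pos by (intro zdiv_mono1) auto
      hence "- int (card {i \<in> I'. v \<notin> M i}) \<le> - int D div int q"
        using q_pos by (subst (asm) nonzero_mult_div_cancel_right) simp_all
      thus ?thesis unfolding D'_def by linarith
    qed
  qed
  moreover have "card I = wt c + card I'"
    unfolding wt_def I'_def using Suc.prems(1)
    by (subst card_Un_disjoint[symmetric]) (auto intro: arg_cong[of _ _ card])
  moreover have "D \<le> wt c"
    using Suc.prems(7)[OF c(1)] by (simp add: wt_def)
  ultimately show ?case
    by (simp add: griesmer_sum_Suc D'_def)
qed

end

section \<open>Additive codes\<close>

text \<open>The list indexes the coordinates of the code. A constant \<open>f\<close> yields its
  length, an indicator \<open>f\<close> the number of kernels through a vector.\<close>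

lemma list_with_multiplicities:
  assumes "finite A"
  shows "\<exists>xs. set xs \<subseteq> A \<and> (\<forall>f :: 'x \<Rightarrow> int. sum_list (map f xs) = (\<Sum>T\<in>A. int (m T) * f T))"
  using assms
proof (induction A)
  case empty
  show ?case by simp
next
  case (insert T A)
  then obtain xs where xs: "set xs \<subseteq> A"
      "\<And>f :: 'x \<Rightarrow> int. sum_list (map f xs) = (\<Sum>T\<in>A. int (m T) * f T)"
    by blast
  show ?case
    using xs(1) insert.hyps
    by (intro exI[of _ "replicate (m T) T @ xs"]) (auto simp: sum_list_replicate xs(2))
qed

lemma finite_hamming_dists:
  assumes "finite C"
  shows "finite {hamming_dist u v | u v. u \<in> C \<and> v \<in> C \<and> u \<noteq> v}"
  by (rule finite_subset[of _ "(\<lambda>(u, v). hamming_dist u v) ` (C \<times> C)"]) (use assms in auto)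

lemma min_hamming_dist_le:
  assumes "finite C" "u \<in> C" "v \<in> C" "u \<noteq> v"
  shows "min_hamming_dist C \<le> hamming_dist u v"
proof -
  show ?thesis
    unfolding min_hamming_dist_def using assms finite_hamming_dists by (intro Min_le) auto
qed

text \<open>The bound on \<open>card C\<close> makes the set of distances nonempty, so that
  \<open>Min\<close> is meaningful.\<close>

lemma min_hamming_dist_ge:
  assumes "finite C" "2 \<le> card C"
    and "\<And>u v. u \<in> C \<Longrightarrow> v \<in> C \<Longrightarrow> u \<noteq> v \<Longrightarrow> d \<le> hamming_dist u v"
  shows "d \<le> min_hamming_dist C"
proof -
  obtain u v where "u \<in> C" "v \<in> C" "u \<noteq> v"
    using assms(2) by (metis card_le_Suc0_iff_eq[OF assms(1)] not_less_eq_eq numeral_2_eq_2)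
  thus ?thesis
    unfolding min_hamming_dist_def using assms(1,3) finite_hamming_dists by (intro Min.boundedI) auto
qed

section \<open>Subfields and subspaces as plain closure conditions\<close>

lemma subfield_space_intro:
  fixes K :: "'a::{field,finite} set" and scale :: "'a \<Rightarrow> 'b::ab_group_add \<Rightarrow> 'b"
  assumes "vector_space scale" "subfield K class_ring" "card K = q"
  shows "subfield_space scale K q"
proof -
  have ring: "ring (class_ring :: 'a ring)"
    using class_field[where 'a = 'a] by (simp add: field_def domain_def cring_def)
  note R = subringE[OF subfieldE(1)[OF assms(2)]]
  have "inverse x \<in> K" if "x \<in> K" for x
  proof (cases "x = 0")
    case True
    thus ?thesis using that by simp
  next
    case False
    thus ?thesis
      using ring.subfield_m_inv(1)[OF ring assms(2), of x] that by (simp add: class_ring_simps)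
  qed
  thus ?thesis
    using assms(1,3) R
    unfolding subfield_space_def subfield_space_axioms_def
    by (auto simp: class_ring_simps)
qed

lemma subspace_module_vec_iff:
  fixes K :: "'a::{field,finite} set"
  assumes "subfield K class_ring"
  shows "VectorSpace.subspace (class_ring\<lparr>carrier := K\<rparr>) C (module_vec TYPE('a) n) \<longleftrightarrow>
           C \<subseteq> carrier_vec n \<and> 0\<^sub>v n \<in> C \<and> (\<forall>u\<in>C. \<forall>v\<in>C. u + v \<in> C) \<and> (\<forall>c\<in>K. \<forall>v\<in>C. c \<cdot>\<^sub>v v \<in> C)"
proof -
  have ring: "ring (class_ring :: 'a ring)"
    using class_field[where 'a = 'a] by (simp add: field_def domain_def cring_def)
  have F: "field (class_ring\<lparr>carrier := K\<rparr>)"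
    by (rule ring.subfield_iff(2)[OF ring assms])
  have M: "module (class_ring\<lparr>carrier := K\<rparr>) (module_vec TYPE('a) n)"
    using vec_module[of n, where 'a = 'a] F
    by (auto simp: module_def module_axioms_def field_def domain_def class_ring_simps)
  show ?thesis
    using F M
    by (auto simp: VectorSpace.subspace_def vectorspace_def LinearCombinations.submodule_def module_vec_simps)
qed

locale additive_code_setting =
  fixes K :: "'a::{field,finite} set" and q h :: nat
  assumes subfield: "subfield K class_ring" and card_K: "card K = q"
    and card_alphabet: "CARD('a) = q ^ h" and h_pos: "1 \<le> h"
begin

sublocale alphabet: subfield_space "(*) :: 'a \<Rightarrow> 'a \<Rightarrow> 'a" K q
  by (rule subfield_space_intro[OF _ subfield card_K]) (simp add: vector_space_def distrib_left distrib_right mult.assoc)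

text \<open>Functions form a group under pointwise addition, unlike the vectors of all lengths in
  \<open>'a vec\<close>.\<close>

sublocale words: subfield_space "\<lambda>(c :: 'a) (f :: nat \<Rightarrow> 'a) i. c * f i" K q
proof (rule subfield_space_intro[OF _ subfield card_K])
  show "vector_space (\<lambda>(c :: 'a) (f :: nat \<Rightarrow> 'a) i. c * f i)"
    by (rule vector_space.intro) (rule ext, simp add: distrib_left distrib_right)+
qed

lemma alphabet_sub_UNIV: "alphabet.sub UNIV"
  by (simp add: alphabet.sub_def)

section \<open>The lower bound, by concatenation with a simplex code\<close>

lemma card_hyperplanes:
  "card (alphabet.intermediate {0} (h - 1) UNIV) = gnum q h"
  using alphabet.card_intermediate_hyperplane[of "{0}" UNIV 0 "h - 1"]
    h_pos card_alphabet alphabet.sub_singleton_zero alphabet_sub_UNIV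
  by simp

text \<open>The constant weight of the simplex code: each nonzero symbol contributes
  \<open>q ^ (h - 1)\<close> after concatenation.\<close>

lemma card_hyperplanes_avoiding:
  assumes "x \<noteq> 0"
  shows "card {H \<in> alphabet.intermediate {0} (h - 1) UNIV. x \<notin> H} = q ^ (h - 1)"
proof -
  let ?\<H> = "alphabet.intermediate {0} (h - 1) UNIV"
  have "card {H \<in> ?\<H>. x \<in> H} = gnum q (h - 1)"
    using alphabet.card_intermediate_hyperplane_mem[of UNIV "{0}" 0 "h - 1" x] assms
      h_pos card_alphabet alphabet.sub_singleton_zero alphabet_sub_UNIV by simp
  moreover have "{H \<in> ?\<H>. x \<notin> H} = ?\<H> - {H \<in> ?\<H>. x \<in> H}" by auto
  moreover have "gnum q h = gnum q (h - 1) + q ^ (h - 1)"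
    using gnum_Suc[of q "h - 1"] h_pos by simp
  ultimately show ?thesis
    using card_hyperplanes by (simp add: card_Diff_subset)
qed

lemma alphabet_eq_adj:
  assumes "H \<in> alphabet.intermediate {0} (h - 1) UNIV" "x \<notin> H"
  shows "alphabet.adj H x = UNIV"
proof (rule card_subset_eq)
  have "q * q ^ (h - 1) = q ^ h" using h_pos by (simp flip: power_Suc)
  thus "card (alphabet.adj H x) = CARD('a)"
    using assms alphabet.card_adj[of H x] by (simp add: alphabet.intermediate_def card_alphabet)
qed auto

text \<open>Pairs of a coordinate and a hyperplane index the concatenated linear code, of length
  \<open>n * [h]\<close> and minimum distance at least \<open>d * q ^ (h - 1)\<close>;
  \<open>griesmer\<close> applies with \<open>Z = {0}\<close>.\<close>

lemma additive_griesmer: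
  assumes "additive_code K n r d C" "1 \<le> r"
  shows "additive_griesmer_bound q h r d \<le> int n"
proof -
  have C: "C \<subseteq> carrier_vec n" "0\<^sub>v n \<in> C" "\<And>u v. u \<in> C \<Longrightarrow> v \<in> C \<Longrightarrow> u + v \<in> C"
      "\<And>c v. c \<in> K \<Longrightarrow> v \<in> C \<Longrightarrow> c \<cdot>\<^sub>v v \<in> C"
    and card_C: "card C = q ^ r" and d: "min_hamming_dist C = d"
    using assms unfolding additive_code_def subspace_module_vec_iff[OF subfield] card_K by blast+
  have "finite C" using card_C alphabet.q_pos by (metis card.infinite power_not_zero less_irrefl)
  \<comment> \<open>The default \<open>0\<close> beyond \<open>n\<close> keeps \<open>F\<close>
    linear on \<open>C\<close>.\<close>
  define F :: "'a vec \<Rightarrow> nat \<Rightarrow> 'a" where "F v i = (if i < n then v $ i else 0)" for v i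
  define V where "V = F ` C"
  have "inj_on F C"
  proof (rule inj_onI)
    fix u v assume "u \<in> C" "v \<in> C" "F u = F v"
    hence "dim_vec u = n" "dim_vec v = n" using C(1) carrier_vecD by blast+
    moreover have "u $ i = v $ i" if "i < n" for i
      using fun_cong[OF \<open>F u = F v\<close>, of i] that by (simp add: F_def)
    ultimately show "u = v"
      by (intro eq_vecI) auto
  qed
  hence card_V: "card V = q ^ r" by (simp add: V_def card_image card_C)
  have F_zero: "F (0\<^sub>v n) = 0" by (auto simp: F_def fun_eq_iff)
  have F_add: "F (u + v) = F u + F v" if "u \<in> C" "v \<in> C" for u v
  proof -
    have "dim_vec v = n" using that C(1) carrier_vecD by blast
    thus ?thesis by (intro ext) (simp add: F_def)
  qed
  have F_scale: "F (c \<cdot>\<^sub>v v) = (\<lambda>i. c * F v i)" if "v \<in> C" for c v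
  proof -
    have "dim_vec v = n" using that C(1) carrier_vecD by blast
    thus ?thesis by (intro ext) (simp add: F_def)
  qed
  have sub_V: "words.sub V"
    unfolding words.sub_def
  proof (intro conjI ballI)
    show "0 \<in> V" using imageI[OF C(2), of F] by (simp add: F_zero V_def)
  next
    fix f g assume "f \<in> V" "g \<in> V"
    then obtain u v where "u \<in> C" "v \<in> C" "f = F u" "g = F v" by (auto simp: V_def)
    thus "f + g \<in> V"
      using imageI[OF C(3)[of u v], of F] by (simp add: F_add V_def)
  next
    fix c f assume "c \<in> K" "f \<in> V"
    then obtain u where "u \<in> C" "f = F u" by (auto simp: V_def)
    thus "(\<lambda>i. c * f i) \<in> V"
      using imageI[OF C(4)[of c u], of F] \<open>c \<in> K\<close> by (simp add: F_scale V_def)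
  qed
  define \<H> where "\<H> = alphabet.intermediate {0} (h - 1) UNIV"
  have \<H>: "alphabet.sub H" if "H \<in> \<H>" for H
    using that by (simp add: \<H>_def alphabet.intermediate_def)
  define I where "I = {..<n} \<times> \<H>"
  define M where "M p = {f \<in> V. f (fst p) \<in> snd p}" for p :: "nat \<times> 'a set"
  have fin: "finite I" "finite V" "finite \<H>"
    using \<open>finite C\<close> by (auto simp: I_def V_def)
  have sub_M: "words.sub (M p) \<and> {0} \<subseteq> M p" if "p \<in> I" for p
  proof -
    have "alphabet.sub (snd p)" using that \<H> by (auto simp: I_def)
    thus ?thesis
      using sub_V unfolding words.sub_def alphabet.sub_def M_def by auto
  qed
  have adj: "V \<subseteq> words.adj (M p) c" if "p \<in> I" "c \<in> V - M p" for p c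
  proof
    fix f assume "f \<in> V"
    have "alphabet.adj (snd p) (c (fst p)) = UNIV"
      using that by (intro alphabet_eq_adj) (auto simp: I_def \<H>_def M_def)
    then obtain w b where wb: "w \<in> snd p" "b \<in> K" "f (fst p) = w + b * c (fst p)"
      unfolding alphabet.adj_def by fast
    have "(\<lambda>i. b * c i) \<in> V"
      using words.sub_scale[OF sub_V wb(2), of c] that by simp
    hence "f - (\<lambda>i. b * c i) \<in> M p"
      using words.sub_diff[OF sub_V \<open>f \<in> V\<close>] wb by (simp add: M_def)
    thus "f \<in> words.adj (M p) c"
      using words.adjI[of "f - (\<lambda>i. b * c i)" "M p" b c] wb by simp
  qed
  have weight: "d * q ^ (h - 1) \<le> card {p \<in> I. f \<notin> M p}" if "f \<in> V - {0}" for f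
  proof -
    obtain u where u: "u \<in> C" "f = F u" using \<open>f \<in> V - {0}\<close> by (auto simp: V_def)
    have "u \<noteq> 0\<^sub>v n" using that u F_zero by auto
    hence "d \<le> hamming_dist u (0\<^sub>v n)"
      using min_hamming_dist_le[OF \<open>finite C\<close> u(1) C(2)] d by simp
    also have "hamming_dist u (0\<^sub>v n) = card {i \<in> {..<n}. f i \<noteq> 0}"
    proof -
      have "dim_vec u = n" using u(1) C(1) carrier_vecD by blast
      hence "{i. i < dim_vec u \<and> u $ i \<noteq> 0\<^sub>v n $ i} = {i \<in> {..<n}. f i \<noteq> 0}"
        by (auto simp: u(2) F_def)
      thus ?thesis by (simp only: hamming_dist_def)
    qed
    finally have "d * q ^ (h - 1) \<le> (\<Sum>i\<in>{i \<in> {..<n}. f i \<noteq> 0}. q ^ (h - 1))" by simp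
    also have "\<dots> = (\<Sum>i\<in>{i \<in> {..<n}. f i \<noteq> 0}. card {H \<in> \<H>. f i \<notin> H})"
      unfolding \<H>_def by (intro sum.cong refl card_hyperplanes_avoiding[symmetric]) auto
    also have "\<dots> = card (SIGMA i:{i \<in> {..<n}. f i \<noteq> 0}. {H \<in> \<H>. f i \<notin> H})"
      using fin by (subst card_SigmaI) auto
    also have "(SIGMA i:{i \<in> {..<n}. f i \<noteq> 0}. {H \<in> \<H>. f i \<notin> H}) = {p \<in> I. f \<notin> M p}"
    proof -
      have "0 \<in> H" if "H \<in> \<H>" for H
        using alphabet.sub_zero[OF \<H>[OF that]] .
      thus ?thesis using \<open>f \<in> V - {0}\<close> by (force simp: I_def M_def)
    qed
    finally show ?thesis .
  qed
  have "griesmer_sum q r (d * q ^ (h - 1)) \<le> int (card I)"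
    using words.griesmer[OF fin(1,2) sub_V words.sub_singleton_zero _ _ sub_M adj weight]
      words.sub_zero[OF sub_V] card_V by simp
  also have "int (card I) = int n * int (gnum q h)"
    using card_hyperplanes by (simp add: I_def \<H>_def card_cartesian_product)
  finally have "real_of_int (griesmer_sum q r (d * q ^ (h - 1))) \<le> real_of_int (int n * int (gnum q h))"
    by (simp only: of_int_le_iff)
  thus ?thesis
    unfolding additive_griesmer_bound_def q_number_gnum[OF alphabet.q_ge_2]
    using gnum_pos[of h q] h_pos
    by (simp add: ceiling_le_iff pos_divide_le_eq)
qed

section \<open>Codes attaining the bound\<close>

text \<open>The support condition drives the induction: the unit vector at \<open>m\<close> lies
  outside the previous space.\<close>

lemma exists_words_subspace:
  "\<exists>V. words.sub V \<and> finite V \<and> card V = q ^ m \<and> (\<forall>f\<in>V. \<forall>i\<ge>m. f i = 0)"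
proof (induction m)
  case 0
  show ?case by (intro exI[of _ "{0}"]) (simp add: words.sub_singleton_zero)
next
  case (Suc m)
  then obtain V where V: "words.sub V" "finite V" "card V = q ^ m" "\<And>f i. f \<in> V \<Longrightarrow> m \<le> i \<Longrightarrow> f i = 0"
    by blast
  define e :: "nat \<Rightarrow> 'a" where "e i = of_bool (i = m)" for i
  have "e \<notin> V" using V(4)[of e m] by (auto simp: e_def)
  moreover have "f i = 0" if "f \<in> words.adj V e" "Suc m \<le> i" for f i
    using that V(4) by (auto simp: words.adj_def e_def)
  ultimately show ?case
    using V(1-3) by (intro exI[of _ "words.adj V e"])
      (simp add: words.sub_adj words.finite_adj words.card_adj)
qed

text \<open>The word of \<open>v\<close> lists the values at \<open>v\<close> of linear maps with
  kernels \<open>xs ! i\<close>. The words of \<open>v\<close> and \<open>w\<close> agree exactly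
  where \<open>v - w\<close> lies in the kernel, at most \<open>n - d\<close> times.\<close>

lemma exists_code_of_multiplicities:
  assumes V: "words.sub V" "finite V" "card V = q ^ (t + h)"
    and "0 < d" and n: "(\<Sum>T\<in>words.intermediate {0} t V. int (m T)) = int n"
    and e: "\<And>v. v \<in> V - {0} \<Longrightarrow>
      (\<Sum>T\<in>words.intermediate {0} t V. int (m T) * of_bool (v \<in> T)) \<le> int n - int d"
  shows "\<exists>C d'. additive_code K n (t + h) d' C \<and> d \<le> d'"
proof -
  define \<T> where "\<T> = words.intermediate {0} t V"
  have "finite \<T>" using V by (simp add: \<T>_def words.finite_intermediate)
  then obtain xs where xs: "set xs \<subseteq> \<T>"
      "\<And>f :: _ \<Rightarrow> int. sum_list (map f xs) = (\<Sum>T\<in>\<T>. int (m T) * f T)"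
    using list_with_multiplicities[of \<T> m] by blast
  have len: "length xs = n"
    using xs(2)[of "\<lambda>_. 1"] n by (simp add: \<T>_def sum_list_triv)
  have cover: "int (card {i \<in> {..<n}. v \<in> xs ! i}) \<le> int n - int d" if "v \<in> V - {0}" for v
    using xs(2)[of "\<lambda>T. of_bool (v \<in> T)"] e[OF that]
    by (simp add: \<T>_def sum_list_sum_nth len lessThan_atLeast0 Int_def)
  have "\<forall>T\<in>\<T>. \<exists>\<phi> :: (nat \<Rightarrow> 'a) \<Rightarrow> 'a. (\<forall>x\<in>V. \<forall>y\<in>V. \<phi> (x + y) = \<phi> x + \<phi> y) \<and>
      (\<forall>c\<in>K. \<forall>x\<in>V. \<phi> (\<lambda>i. c * x i) = c * \<phi> x) \<and> (\<forall>x\<in>V. \<phi> x = 0 \<longleftrightarrow> x \<in> T)"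
  proof
    fix T assume "T \<in> \<T>"
    hence T: "words.sub T" "T \<subseteq> V" "card T = q ^ t"
      by (simp_all add: \<T>_def words.intermediate_def)
    have "q ^ h \<le> CARD('a)" by (simp add: card_alphabet)
    from words.linear_map_with_kernel[OF T(1) V(1,2) T(2,3) V(3) this]
    show "\<exists>\<phi> :: (nat \<Rightarrow> 'a) \<Rightarrow> 'a. (\<forall>x\<in>V. \<forall>y\<in>V. \<phi> (x + y) = \<phi> x + \<phi> y) \<and>
        (\<forall>c\<in>K. \<forall>x\<in>V. \<phi> (\<lambda>i. c * x i) = c * \<phi> x) \<and> (\<forall>x\<in>V. \<phi> x = 0 \<longleftrightarrow> x \<in> T)"
      by blast
  qed
  from bchoice[OF this] obtain \<Phi> :: "(nat \<Rightarrow> 'a) set \<Rightarrow> (nat \<Rightarrow> 'a) \<Rightarrow> 'a" where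
    \<Phi>: "\<forall>T\<in>\<T>. (\<forall>x\<in>V. \<forall>y\<in>V. \<Phi> T (x + y) = \<Phi> T x + \<Phi> T y) \<and>
      (\<forall>c\<in>K. \<forall>x\<in>V. \<Phi> T (\<lambda>i. c * x i) = c * \<Phi> T x) \<and> (\<forall>x\<in>V. \<Phi> T x = 0 \<longleftrightarrow> x \<in> T)"
    by (rule exE)
  have add: "\<Phi> T (x + y) = \<Phi> T x + \<Phi> T y" if "T \<in> \<T>" "x \<in> V" "y \<in> V" for T x y
    using bspec[OF \<Phi> that(1)] that by simp
  have scale: "\<Phi> T (\<lambda>i. c * x i) = c * \<Phi> T x" if "T \<in> \<T>" "c \<in> K" "x \<in> V" for T c x
    using bspec[OF \<Phi> that(1)] that by simp
  have ker: "\<Phi> T x = 0 \<longleftrightarrow> x \<in> T" if "T \<in> \<T>" "x \<in> V" for T x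
    using bspec[OF \<Phi> that(1)] that by simp
  have nth: "xs ! i \<in> \<T>" if "i < n" for i
    using xs(1) that len by (metis nth_mem subsetD)
  define cw where "cw v = vec n (\<lambda>i. \<Phi> (xs ! i) v)" for v
  have diff: "\<Phi> T v = \<Phi> T w \<longleftrightarrow> v - w \<in> T" if "T \<in> \<T>" "v \<in> V" "w \<in> V" for T v w
    using add[of T "v - w" w] ker[of T "v - w"] that words.sub_diff[OF V(1), of v w] by auto
  have dist: "d \<le> hamming_dist (cw v) (cw w)" if "v \<in> V" "w \<in> V" "v \<noteq> w" for v w
  proof -
    have "v - w \<in> V - {0}" using that V words.sub_diff by auto
    note cov = cover[OF this]
    have diffs: "{i. i < dim_vec (cw v) \<and> cw v $ i \<noteq> cw w $ i} = {..<n} - {i \<in> {..<n}. v - w \<in> xs ! i}"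
      using that diff nth by (auto simp: cw_def)
    have "card ({..<n} - {i \<in> {..<n}. v - w \<in> xs ! i}) = n - card {i \<in> {..<n}. v - w \<in> xs ! i}"
      by (subst card_Diff_subset) auto
    thus ?thesis
      unfolding hamming_dist_def diffs using cov by linarith
  qed
  have "inj_on cw V"
  proof (rule inj_onI, rule ccontr)
    fix v w assume "v \<in> V" "w \<in> V" "cw v = cw w" "v \<noteq> w"
    thus False using dist[of v w] \<open>0 < d\<close> by (simp add: hamming_dist_def)
  qed
  define C where "C = cw ` V"
  have "finite C" and card_C: "card C = q ^ (t + h)"
    using V \<open>inj_on cw V\<close> by (simp_all add: C_def card_image)
  have "q ^ 1 \<le> q ^ (t + h)" using alphabet.q_pos h_pos by (intro power_increasing) auto
  hence "2 \<le> card C" using alphabet.q_ge_2 card_C by simp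
  hence "d \<le> min_hamming_dist C"
    using \<open>finite C\<close> dist by (intro min_hamming_dist_ge) (auto simp: C_def)
  moreover have "VectorSpace.subspace (class_ring\<lparr>carrier := K\<rparr>) C (module_vec TYPE('a) n)"
    unfolding subspace_module_vec_iff[OF subfield]
  proof (intro conjI ballI)
    show "C \<subseteq> carrier_vec n" by (auto simp: C_def cw_def)
    have "cw 0 = 0\<^sub>v n"
      using nth ker words.sub_zero[OF V(1)]
      by (intro eq_vecI) (auto simp: cw_def \<T>_def words.intermediate_def)
    thus "0\<^sub>v n \<in> C" using imageI[OF words.sub_zero[OF V(1)], of cw] by (simp add: C_def)
  next
    fix u v assume "u \<in> C" "v \<in> C"
    then obtain x y where 1: "x \<in> V" "y \<in> V" "u = cw x" "v = cw y" by (auto simp: C_def)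
    hence "u + v = cw (x + y)" using nth add by (intro eq_vecI) (auto simp: cw_def)
    thus "u + v \<in> C" using 1 words.sub_add[OF V(1)] by (auto simp: C_def)
  next
    fix c u assume "c \<in> K" "u \<in> C"
    then obtain x where 1: "x \<in> V" "u = cw x" by (auto simp: C_def)
    hence "c \<cdot>\<^sub>v u = cw (\<lambda>i. c * x i)" using nth scale \<open>c \<in> K\<close> by (intro eq_vecI) (auto simp: cw_def)
    thus "c \<cdot>\<^sub>v u \<in> C" using 1 words.sub_scale[OF V(1) \<open>c \<in> K\<close>] by (auto simp: C_def)
  qed
  ultimately show ?thesis
    using card_C card_K unfolding additive_code_def by blast
qed

lemma excess_mono:
  assumes "d \<le> d'"
  shows "excess q h t (int d) \<le> excess q h t (int d')"
proof -
  have "ceil_sum q t (int d) \<le> ceil_sum q t (int d')"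
    unfolding ceil_sum_def
    using assms alphabet.q_pos by (intro sum_mono) (simp add: zdiv_mono1)
  thus ?thesis
    unfolding excess_def using gnum_pos[of h q] h_pos by (simp add: zdiv_mono1)
qed

text \<open>The construction gives some \<open>d' \<ge> d\<close>. The lower bound for
  \<open>d'\<close> at the same length and the strict growth of \<open>d + excess\<close> force
  \<open>d' = d\<close>.\<close>

lemma additive_griesmer_attained:
  assumes "1 \<le> t"
  shows "\<exists>D. \<forall>d\<ge>D. \<exists>n C. additive_code K n (t + h) d C \<and>
           int n = additive_griesmer_bound q h (t + h) d"
proof -
  obtain V where V: "words.sub V" "finite V" "card V = q ^ (t + h)"
    using exists_words_subspace by blast
  have bound: "additive_griesmer_bound q h (t + h) d = int d + excess q h t (int d)" for d
    using additive_griesmer_bound_eq[OF alphabet.q_ge_2 h_pos, of t d] by (simp add: add.commute)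
  obtain D where D: "\<And>d. D \<le> d \<Longrightarrow> \<exists>m :: (nat \<Rightarrow> 'a) set \<Rightarrow> nat.
      (\<Sum>T\<in>words.intermediate {0} t V. int (m T)) = int d + excess q h t (int d) \<and>
      (\<forall>v\<in>V - {0}. (\<Sum>T\<in>words.intermediate {0} t V. int (m T) * of_bool (v \<in> T)) \<le> excess q h t (int d))"
    using words.subspace_multiplicities[OF V assms h_pos] by blast
  \<comment> \<open>\<open>Suc D\<close> also makes \<open>d\<close> positive, as the construction
    demands.\<close>
  have "\<exists>n C. additive_code K n (t + h) d C \<and> int n = additive_griesmer_bound q h (t + h) d"
    if "Suc D \<le> d" for d
  proof -
    obtain m :: "(nat \<Rightarrow> 'a) set \<Rightarrow> nat" where
      m: "(\<Sum>T\<in>words.intermediate {0} t V. int (m T)) = int d + excess q h t (int d)"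
        "\<And>v. v \<in> V - {0} \<Longrightarrow>
          (\<Sum>T\<in>words.intermediate {0} t V. int (m T) * of_bool (v \<in> T)) \<le> excess q h t (int d)"
      using D[OF Suc_leD[OF \<open>Suc D \<le> d\<close>]] by blast
    define n where "n = (\<Sum>T\<in>words.intermediate {0} t V. m T)"
    have n: "int n = int d + excess q h t (int d)" using m(1) by (simp add: n_def)
    have "\<exists>C d'. additive_code K n (t + h) d' C \<and> d \<le> d'"
    proof (rule exists_code_of_multiplicities[OF V])
      show "(\<Sum>T\<in>words.intermediate {0} t V. int (m T)) = int n" by (simp add: n_def)
    qed (use that n m(2) in auto)
    then obtain C d' where C: "additive_code K n (t + h) d' C" "d \<le> d'" by blast
    have "int d' + excess q h t (int d') \<le> int d + excess q h t (int d)"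
      using additive_griesmer[OF C(1)] h_pos n by (simp add: bound)
    hence "d' = d" using excess_mono[OF C(2), of t] C(2) by linarith
    thus ?thesis using C(1) n bound by auto
  qed
  thus ?thesis by blast
qed

end

section \<open>Asymptotics\<close>

text \<open>Each of the \<open>t\<close> ceilings adds at most \<open>1\<close>, and the unrounded
  terms form a geometric sum.\<close>

lemma ceil_sum_bounds:
  assumes "0 < q"
  shows "real d * real (gnum q t) / real q ^ t \<le> of_int (ceil_sum q t (int d))"
    and "of_int (ceil_sum q t (int d)) \<le> real d * real (gnum q t) / real q ^ t + real t"
proof -
  have ceil: "of_int (ceil_sum q t (int d)) = (\<Sum>i<t. real_of_int \<lceil>real d / real q ^ Suc i\<rceil>)"
    unfolding ceil_sum_def of_int_sum
  proof (intro sum.cong refl arg_cong[of _ _ real_of_int])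
    show "- (- int d div int q ^ Suc i) = \<lceil>real d / real q ^ Suc i\<rceil>" for i
      using ceiling_divide_eq_div[of "int d" "int q ^ Suc i", where 'a = real] by simp
  qed
  have "real q ^ t = real q ^ (t - Suc i) * real q ^ Suc i" if "i < t" for i
    using that by (simp only: power_add[symmetric]) simp
  hence "real d / real q ^ Suc i = real d * real q ^ (t - Suc i) / real q ^ t" if "i < t" for i
    using that assms by simp
  hence "(\<Sum>i<t. real d / real q ^ Suc i) = (\<Sum>i<t. real d * real q ^ (t - Suc i) / real q ^ t)"
    by (intro sum.cong) auto
  also have "\<dots> = real d * real (gnum q t) / real q ^ t"
    by (simp add: gnum_def sum.nat_diff_reindex flip: sum_distrib_left sum_divide_distrib)
  finally have sum: "(\<Sum>i<t. real d / real q ^ Suc i) = real d * real (gnum q t) / real q ^ t" .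
  show "real d * real (gnum q t) / real q ^ t \<le> of_int (ceil_sum q t (int d))"
    unfolding ceil sum[symmetric] by (intro sum_mono) simp
  have "(\<Sum>i<t. real_of_int \<lceil>real d / real q ^ Suc i\<rceil>) \<le> (\<Sum>i<t. real d / real q ^ Suc i + 1)"
    by (intro sum_mono) (use of_int_ceiling_le_add_one in blast)
  thus "of_int (ceil_sum q t (int d)) \<le> real d * real (gnum q t) / real q ^ t + real t"
    unfolding ceil sum[symmetric] by (simp add: sum.distrib)
qed

lemma excess_eq_ceiling: "excess q h t d = \<lceil>of_int (ceil_sum q t d) / real (gnum q h)\<rceil>"
  using ceiling_divide_eq_div[of "ceil_sum q t d" "int (gnum q h)", where 'a = real]
  by (simp add: excess_def)

text \<open>All ceilings together cost at most the constant \<open>B\<close>, which vanishes after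
  division by \<open>d j\<close>.\<close>

lemma excess_ratio_tendsto:
  assumes "0 < q" "0 < h" and d: "filterlim d at_top sequentially"
  shows "(\<lambda>j. of_int (excess q h t (int (d j))) / real (d j))
           \<longlonglongrightarrow> real (gnum q t) / (real q ^ t * real (gnum q h))"
proof -
  define g where "g = real (gnum q h)"
  define L where "L = real (gnum q t) / (real q ^ t * g)"
  define B where "B = real t / g + 1"
  have g: "0 < g" using gnum_pos[OF assms(2), of q] by (simp add: g_def)
  have dr: "filterlim (\<lambda>j. real (d j)) at_top sequentially"
    by (rule filterlim_compose[OF filterlim_real_sequentially d])
  have "(\<lambda>j. B / real (d j)) \<longlonglongrightarrow> 0"
    by (rule tendsto_divide_0[OF tendsto_const filterlim_at_top_imp_at_infinity[OF dr]])
  hence up: "(\<lambda>j. L + B / real (d j)) \<longlonglongrightarrow> L"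
    using tendsto_add[OF tendsto_const, of _ 0 sequentially L] by simp
  have pos: "\<forall>\<^sub>F j in sequentially. 0 < d j"
    using d[unfolded filterlim_at_top, rule_format, of 1] by (rule eventually_mono) simp
  have "L \<le> of_int (excess q h t (int m)) / real m"
    "of_int (excess q h t (int m)) / real m \<le> L + B / real m" if "0 < m" for m
  proof -
    note b = ceil_sum_bounds[OF assms(1), where d = m and t = t]
    have "L * real m = real m * real (gnum q t) / real q ^ t / g"
      by (simp add: L_def)
    also have "\<dots> \<le> of_int (ceil_sum q t (int m)) / g"
      using b(1) g by (intro divide_right_mono) auto
    also have "\<dots> \<le> of_int (excess q h t (int m))"
      unfolding excess_eq_ceiling g_def by (rule le_of_int_ceiling)
    finally show "L \<le> of_int (excess q h t (int m)) / real m"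
      using that by (simp add: pos_le_divide_eq)
    have "of_int (excess q h t (int m)) \<le> of_int (ceil_sum q t (int m)) / g + 1"
      unfolding excess_eq_ceiling g_def by (rule of_int_ceiling_le_add_one)
    also have "\<dots> \<le> (real m * real (gnum q t) / real q ^ t + real t) / g + 1"
      using b(2) g by (intro add_right_mono divide_right_mono) auto
    also have "\<dots> = L * real m + B"
      by (simp add: L_def B_def add_divide_distrib)
    finally show "of_int (excess q h t (int m)) / real m \<le> L + B / real m"
      using that by (simp add: field_simps)
  qed
  hence "(\<lambda>j. of_int (excess q h t (int (d j))) / real (d j)) \<longlonglongrightarrow> L"
    by (intro tendsto_sandwich[OF _ _ tendsto_const up]; intro eventually_mono[OF pos]) auto
  thus ?thesis by (simp add: L_def g_def)
qed

text \<open>\<open>n / d\<close> is \<open>1 + excess / d\<close>, and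
  \<open>[t + h] = [t] + q ^ t * [h]\<close> evaluates the limit.\<close>

lemma relative_distance_tendsto:
  assumes "0 < q" "0 < h" and d: "filterlim d at_top sequentially"
    and n: "\<And>j. int (n j) = int (d j) + excess q h t (int (d j))"
  shows "(\<lambda>j. real (d j) / real (n j)) \<longlonglongrightarrow> real q ^ t * real (gnum q h) / real (gnum q (t + h))"
proof -
  define L where "L = real (gnum q t) / (real q ^ t * real (gnum q h))"
  have g: "0 < real (gnum q h)" using gnum_pos[OF assms(2), of q] by simp
  have "0 \<le> L" by (simp add: L_def)
  have pos: "\<forall>\<^sub>F j in sequentially. 0 < d j"
    using d[unfolded filterlim_at_top, rule_format, of 1] by (rule eventually_mono) simp
  have "(\<lambda>j. inverse (1 + of_int (excess q h t (int (d j))) / real (d j))) \<longlonglongrightarrow> inverse (1 + L)"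
    using excess_ratio_tendsto[OF assms(1,2) d, of t] \<open>0 \<le> L\<close> unfolding L_def[symmetric]
    by (intro tendsto_intros) simp_all
  moreover have "\<forall>\<^sub>F j in sequentially.
      inverse (1 + of_int (excess q h t (int (d j))) / real (d j)) = real (d j) / real (n j)"
    using pos
  proof eventually_elim
    case (elim j)
    have "real (n j) = real (d j) + of_int (excess q h t (int (d j)))"
      using arg_cong[OF n[of j], of real_of_int] by simp
    thus ?case using elim by (simp add: field_simps)
  qed
  moreover have "inverse (1 + L) = real q ^ t * real (gnum q h) / real (gnum q (t + h))"
  proof -
    have *: "real (gnum q (t + h)) = real q ^ t * real (gnum q h) * (1 + L)"
      using g assms(1) unfolding gnum_add L_def by (simp add: field_simps)
    show ?thesis unfolding * using g assms(1) by (simp add: inverse_eq_divide)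
  qed
  ultimately show ?thesis
    by (simp only: tendsto_cong)
qed

text \<open>The difference is \<open>(x - 1) / (x * (x powr k - 1))\<close>, of exact order
  \<open>x powr (- k)\<close>. An error of order \<open>x powr (- 2)\<close> thus needs
  \<open>k \<ge> 2\<close>, which is why the theorem treats \<open>k < 2\<close> separately.\<close>

lemma relative_distance_expansion:
  fixes k p :: real
  assumes "1 \<le> k" "p \<le> k"
  shows "(\<lambda>x. x powr (k - 1) / q_number x k - (1 - 1 / x)) \<in> O[at_top](\<lambda>x. x powr (- p))"
proof (rule bigoI[of _ 2])
  show "\<forall>\<^sub>F x in at_top. norm (x powr (k - 1) / q_number x k - (1 - 1 / x)) \<le> 2 * norm (x powr (- p))"
    using eventually_ge_at_top[of 2]
  proof eventually_elim
    case (elim x)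
    define X where "X = x powr k"
    have "x powr 1 \<le> X" unfolding X_def using elim assms by (intro powr_mono) auto
    hence X: "2 \<le> X" using elim by simp
    have "x powr (k - 1) / q_number x k = (X / x) / ((X - 1) / (x - 1))"
      using elim by (simp add: q_number_def X_def powr_diff)
    also have "\<dots> = (1 - 1 / x) + (x - 1) / x * (1 / (X - 1))"
      using X elim by (simp add: divide_simps) (simp add: algebra_simps)
    finally have "x powr (k - 1) / q_number x k - (1 - 1 / x) = (x - 1) / x * (1 / (X - 1))"
      by simp
    \<comment> \<open>\<open>1 / (X - 1) \<le> 2 / X\<close> because
      \<open>X \<ge> 2\<close>.\<close>
    moreover have "\<dots> \<le> 1 * (2 / X)"
      using X elim by (intro mult_mono) (auto simp: field_simps)
    moreover have "0 \<le> (x - 1) / x * (1 / (X - 1))" using X elim by simp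
    moreover have "2 / X = 2 * x powr (- k)"
      by (simp add: X_def powr_minus divide_inverse)
    moreover have "x powr (- k) \<le> x powr (- p)"
      using elim assms by (intro powr_mono) auto
    ultimately have "\<bar>x powr (k - 1) / q_number x k - (1 - 1 / x)\<bar> \<le> 2 * x powr (- p)"
      by linarith
    thus ?case by simp
  qed
qed

theorem corollary6:
  fixes K :: "'a::{field,finite} set" and q r h :: nat and k Q :: real
  assumes "primepow q"
    and "1 \<le> h" and "h < r"
    and "subfield K class_ring" and "card K = q" and "CARD('a) = q ^ h"
    and k_def: "k = real r / real h"
    and Q_def: "Q = real q ^ h"
  shows
    "(\<forall>n d C. additive_code K n r d C \<longrightarrow> int n \<ge> additive_griesmer_bound q h r d) \<and>
     (\<forall>d>0.
        additive_griesmer_bound q h r d =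
          \<lceil>of_int (\<Sum>i<r. \<lceil>real d * real q powi (int h - 1 - int i)\<rceil>) / q_number (real q) (real h)\<rceil> \<and>
        additive_griesmer_bound q h r d =
          int d + \<lceil>of_int (griesmer_sum q (r - h + 1) d - int d) / q_number (real q) (real h)\<rceil>) \<and>
     (\<exists>D. \<forall>d\<ge>D. \<exists>n C. additive_code K n r d C \<and> int n = additive_griesmer_bound q h r d) \<and>
     (\<forall>n d :: nat \<Rightarrow> nat. \<forall>C :: nat \<Rightarrow> 'a vec set.
        (\<forall>j. additive_code K (n j) r (d j) (C j) \<and>
             int (n j) = additive_griesmer_bound q h r (d j)) \<and>
        filterlim d at_top sequentially \<longrightarrow>
          (\<lambda>j. real (d j) / real (n j)) \<longlonglongrightarrow> Q powr (k - 1) / q_number Q k \<and>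
          (\<lambda>j. k / real (n j)) \<longlonglongrightarrow> 0) \<and>
     (2 \<le> k \<longrightarrow>
        (\<lambda>x::real. x powr (k - 1) / q_number x k - (1 - 1 / x)) \<in> O[at_top](\<lambda>x. x powr (-2))) \<and>
     (k < 2 \<longrightarrow>
        (\<lambda>x::real. x powr (k - 1) / q_number x k - (1 - 1 / x)) \<in> O[at_top](\<lambda>x. x powr (-k)))"
proof -
  interpret additive_code_setting K q h
    by (rule additive_code_setting.intro) (fact assms)+
  note q2 = alphabet.q_ge_2
  define t where "t = r - h"
  have r: "r = h + t" "r = t + h" and "1 \<le> t" using \<open>h < r\<close> by (simp_all add: t_def)
  have bound: "additive_griesmer_bound q h r d = int d + excess q h t (int d)" for d
    unfolding r(1) by (rule additive_griesmer_bound_eq[OF q2 h_pos])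
  have "1 \<le> k" using \<open>h < r\<close> \<open>1 \<le> h\<close> by (simp add: k_def)

  have forms: "additive_griesmer_bound q h r d =
        \<lceil>of_int (\<Sum>i<r. \<lceil>real d * real q powi (int h - 1 - int i)\<rceil>) / q_number (real q) (real h)\<rceil>"
      "additive_griesmer_bound q h r d =
        int d + \<lceil>of_int (griesmer_sum q (r - h + 1) d - int d) / q_number (real q) (real h)\<rceil>" for d
  proof -
    \<comment> \<open>The exponent is negative once \<open>i \<ge> h\<close>, hence
      \<open>powi\<close>.\<close>
    have "real d * real q powi (int h - 1 - int i) = real (d * q ^ (h - 1)) / real q ^ i" for i
    proof -
      have "real q powi (int h - 1 - int i) = real q powi int (h - 1) / real q powi int i"
        using q2 h_pos by (subst power_int_diff[symmetric]) (auto simp: of_nat_diff)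
      thus ?thesis by simp
    qed
    thus "additive_griesmer_bound q h r d =
        \<lceil>of_int (\<Sum>i<r. \<lceil>real d * real q powi (int h - 1 - int i)\<rceil>) / q_number (real q) (real h)\<rceil>"
      by (simp only: additive_griesmer_bound_def griesmer_sum_def)
    show "additive_griesmer_bound q h r d =
        int d + \<lceil>of_int (griesmer_sum q (r - h + 1) d - int d) / q_number (real q) (real h)\<rceil>"
      using griesmer_sum_residual[of q t d]
      by (simp add: bound excess_eq_ceiling q_number_gnum[OF q2] t_def)
  qed

  \<comment> \<open>Since \<open>Q powr k = q ^ r\<close>, the number \<open>[k]\<close> to the base
    \<open>Q\<close> is \<open>[r] / [h]\<close> to the base \<open>q\<close>, and the fractional
    index disappears.\<close>
  have limit: "Q powr (k - 1) / q_number Q k = real q ^ t * real (gnum q h) / real (gnum q r)"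
  proof -
    have Q: "Q powr x = real q powr (real h * x)" for x
      using q2 by (simp add: Q_def powr_powr flip: powr_realpow)
    have "real h * k = real r" using h_pos by (simp add: k_def)
    hence "Q powr k = real q ^ r"
      using q2 by (simp add: Q powr_realpow)
    have "real h * (k - 1) = real t"
      using \<open>real h * k = real r\<close> \<open>h < r\<close> by (simp add: right_diff_distrib t_def of_nat_diff)
    hence "Q powr (k - 1) = real q ^ t"
      using q2 by (simp add: Q powr_realpow)
    moreover have "q_number Q k = real (gnum q r) / real (gnum q h)"
      using q2 \<open>Q powr k = real q ^ r\<close> unfolding q_number_gnum[OF q2, symmetric]
      by (simp add: q_number_def Q_def powr_realpow)
    ultimately show ?thesis by simp
  qed

  have asymptotics: "(\<lambda>j. real (d j) / real (n j)) \<longlonglongrightarrow> Q powr (k - 1) / q_number Q k"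
      "(\<lambda>j. k / real (n j)) \<longlonglongrightarrow> 0"
    if n: "\<And>j. int (n j) = additive_griesmer_bound q h r (d j)"
      and d: "filterlim d at_top sequentially" for n d :: "nat \<Rightarrow> nat"
  proof -
    have n': "int (n j) = int (d j) + excess q h t (int (d j))" for j
      using n bound by simp
    show "(\<lambda>j. real (d j) / real (n j)) \<longlonglongrightarrow> Q powr (k - 1) / q_number Q k"
      unfolding limit unfolding r(2)
      by (rule relative_distance_tendsto[OF _ _ d n']) (use q2 h_pos in auto)
    \<comment> \<open>\<open>excess\<close> vanishes at \<open>0\<close> and is monotone; so
      \<open>d j \<le> n j\<close>, and the length tends to infinity.\<close>
    have "0 \<le> excess q h t (int m)" for m
      using excess_mono[of 0 m t] by (simp add: excess_def ceil_sum_def)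
    hence "d j \<le> n j" for j
      using n'[of j] by (metis le_add_same_cancel1 of_nat_le_iff)
    hence "filterlim n at_top sequentially"
      by (intro filterlim_at_top_mono[OF d]) simp
    hence "filterlim (\<lambda>j. real (n j)) at_top sequentially"
      by (rule filterlim_compose[OF filterlim_real_sequentially])
    thus "(\<lambda>j. k / real (n j)) \<longlonglongrightarrow> 0"
      by (rule tendsto_divide_0[OF tendsto_const filterlim_at_top_imp_at_infinity])
  qed

  show ?thesis
  proof (intro conjI allI impI)
    show "additive_griesmer_bound q h r d \<le> int n" if "additive_code K n r d C" for n d C
      using additive_griesmer[OF that] \<open>h < r\<close> by simp
    show "\<exists>D. \<forall>d\<ge>D. \<exists>n C. additive_code K n r d C \<and> int n = additive_griesmer_bound q h r d"
      unfolding r(2) by (rule additive_griesmer_attained[OF \<open>1 \<le> t\<close>])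
    show "(\<lambda>x. x powr (k - 1) / q_number x k - (1 - 1 / x)) \<in> O[at_top](\<lambda>x. x powr (-2))" if "2 \<le> k"
      using \<open>1 \<le> k\<close> that by (rule relative_distance_expansion)
    show "(\<lambda>x. x powr (k - 1) / q_number x k - (1 - 1 / x)) \<in> O[at_top](\<lambda>x. x powr (-k))"
      using \<open>1 \<le> k\<close> order_refl by (rule relative_distance_expansion)
  qed (use forms asymptotics in auto)
qed

end
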